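(* Let $(\mathbb{H},\mu,\eta,\Delta,\epsilon)$ be a weak $\bm k$-bialgebra, and define the subalgebra $$\mathcal{B}:=\Delta(1)(\mathbb{H}\otimes\mathbb{H})\Delta(1)\subset\mathbb{H}\otimes\mathbb{H}.$$ Let $A=\Pi^L(\mathbb{H})$ and let $\pi\colon\mathbb{H}\otimes_{\bm k}\mathbb{H}\to\mathbb{H}\otimes_A\mathbb{H}$ be the projection. Then $\mathbb{H}$ with multiplication $\mu$, source map the inclusion $\alpha\colon\Pi^L(\mathbb{H})\hookrightarrow\mathbb{H}$, target map $\beta=\bar\Pi^L|_A$, comultiplication $\pi|_{\mathcal{B}}\circ\Delta$ and counit $\Pi^L$ is a left $\Pi^L(\mathbb{H})$-bialgebroid with balancing subalgebra $\mathcal{B}$.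
   Context: Let $\bm k$ be a field, $\otimes=\otimes_{\bm k}$. **Weak bialgebra.** A weak $\bm k$-bialgebra $(\mathbb{H},\mu,\eta,\Delta,\epsilon)$ is an associative unital algebra $(\mathbb H,\mu,\eta)$ and a coassociative counital coalgebra $(\mathbb H,\Delta,\epsilon)$ such that: $\Delta(ab)=\Delta(a)\Delta(b)$; $\epsilon(xyz)=\epsilon(xy_{(1)})\epsilon(y_{(2)}z)=\epsilon(xy_{(2)})\epsilon(y_{(1)}z)$ for all $x,y,z$; and $(\Delta\otimes\mathrm{id})\Delta(1)=(\Delta(1)\otimes1)(1\otimes\Delta(1))=(1\otimes\Delta(1))(\Delta(1)\otimes1)$. Write $\Delta(1)=1_{(1)}\otimes1_{(2)}$ and define $\Pi^L(x)=\epsilon(1_{(1)}x)1_{(2)}$, $\bar\Pi^L(x)=\epsilon(1_{(2)}x)1_{(1)}$. **Bialgebroid with balancing subalgebra.** For a unital algebra $A$: an $A\otimes A^{\mathrm{op}}$-ring $(H,\mu,\alpha,\beta)$ is a unital algebra with unital algebra homomorphisms $\alpha\colon A\to H$ (source), $\beta\colon A^{\mathrm{op}}\to H$ (target) with commuting images. An $A$-coring is an $A$-bimodule $H$ with a coassociative bimodule map $\Delta'\colon H\to H\otimes_AH$ and a bimodule map counit $\epsilon'\colon H\to A$. Let $\pi\colon H\otimes H\to H\otimes_AH$ be the projection and $I_A=\operatorname{Ker}\pi$, the right ideal generated by all $\beta(a)\otimes1-1\otimes\alpha(a)$. A left $A$-bialgebroid with balancing subalgebra $\mathcal{B}$ consists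 of such a ring and coring and a (not necessarily unital) subalgebra $\mathcal{B}\subset H\otimes H$ with: (C1) the bimodule structure is $a.h.b=\alpha(a)\beta(b)h$; (C2) $h\triangleright a:=\epsilon'(h\alpha(a))$ is an action of $H$ on $A$; (C3MI) $I_A\cap\mathcal{B}$ is a two-sided ideal in $\mathcal{B}$; (C3Ma) $\mathrm{Im}\,\Delta'\subset\mathcal{B}/(I_A\cap\mathcal{B})$ (identified with $\pi(\mathcal{B})\subset H\otimes_AH$); (C3Mb) $\Delta'\colon H\to\mathcal{B}/(I_A\cap\mathcal{B})$ is a homomorphism of algebras (multiplicative, with $\Delta'(1)=1\otimes_A1$). *)

theory Defs
  imports Complex_Main "HOL-Library.Poly_Mapping"
begin

section \<open>Free vector spaces and their quotients\<close>

text \<open>The type \<open>'x \<Rightarrow>\<^sub>0 'k\<close> of finitely supported functions is the \<open>'k\<close>-vector space with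
  basis \<open>gen p\<close>, where \<open>p :: 'x\<close>. Poly_Mapping has no scalar multiplication.\<close>

definition fscale :: "'k::field \<Rightarrow> ('x \<Rightarrow>\<^sub>0 'k) \<Rightarrow> ('x \<Rightarrow>\<^sub>0 'k)" where
  "fscale c f = Poly_Mapping.map ((*) c) f"

lemma lookup_fscale [simp]: "Poly_Mapping.lookup (fscale c f) p = c * Poly_Mapping.lookup f p"
  by (simp add: fscale_def Poly_Mapping.map.rep_eq when_def)

interpretation free: vector_space "fscale :: 'k::field \<Rightarrow> ('x \<Rightarrow>\<^sub>0 'k) \<Rightarrow> _"
  by unfold_locales (rule poly_mapping_eqI; simp add: lookup_add algebra_simps)+

abbreviation gen :: "'x \<Rightarrow> ('x \<Rightarrow>\<^sub>0 'k::field)" where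
  "gen p \<equiv> Poly_Mapping.single p 1"

text \<open>\<open>fext s g\<close> is the linear extension of \<open>gen p \<mapsto> g p\<close> to a space with scalar
  multiplication \<open>s\<close>.\<close>

definition fext :: "('k::field \<Rightarrow> 'v::ab_group_add \<Rightarrow> 'v) \<Rightarrow> ('x \<Rightarrow> 'v) \<Rightarrow> ('x \<Rightarrow>\<^sub>0 'k) \<Rightarrow> 'v" where
  "fext s g f = (\<Sum>p\<in>Poly_Mapping.keys f. s (Poly_Mapping.lookup f p) (g p))"

lemma fext_superset:
  assumes "vector_space s" "finite S" "Poly_Mapping.keys f \<subseteq> S"
  shows "fext s g f = (\<Sum>p\<in>S. s (Poly_Mapping.lookup f p) (g p))"
proof -
  interpret vector_space s by fact
  show ?thesis
    unfolding fext_def by (rule sum.mono_neutral_left) (use assms in \<open>auto simp: in_keys_iff\<close>)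
qed

lemma linear_fext:
  assumes "vector_space s"
  shows "Vector_Spaces.linear fscale s (fext s g)"
proof -
  interpret V: vector_space s by fact
  show ?thesis
  proof (unfold_locales, goal_cases)
    case (1 f h)
    have "Poly_Mapping.keys (f + h) \<subseteq> Poly_Mapping.keys f \<union> Poly_Mapping.keys h"
      by (rule keys_add)
    then show ?case
      by (simp add: fext_superset[OF assms, where S = "Poly_Mapping.keys f \<union> Poly_Mapping.keys h"]
          lookup_add V.scale_left_distrib sum.distrib)
  next
    case (2 c f)
    have "Poly_Mapping.keys (fscale c f) \<subseteq> Poly_Mapping.keys f"
      by (auto simp: in_keys_iff)
    then show ?case
      by (simp add: fext_superset[OF assms, where S = "Poly_Mapping.keys f"] V.scale_sum_right)
  qed
qed

lemma fext_gen:
  assumes "vector_space s"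
  shows "fext s g (gen p) = g p"
proof -
  interpret vector_space s by fact
  show ?thesis by (simp add: fext_def)
qed

text \<open>Elements of the quotient by a subspace \<open>N\<close> are cosets. Operations and maps on a quotient
  are given on representatives. Those below are used only where the result does not depend on
  the representative chosen by \<open>rep\<close>.\<close>

definition cls :: "'v::ab_group_add set \<Rightarrow> 'v \<Rightarrow> 'v set" where
  "cls N f = {g. g - f \<in> N}"

definition quot :: "'v::ab_group_add set \<Rightarrow> 'v set set" where
  "quot N = range (cls N)"

definition rep :: "'v set \<Rightarrow> 'v" where
  "rep t = (SOME f. f \<in> t)"

definition qadd :: "'v::ab_group_add set \<Rightarrow> 'v set \<Rightarrow> 'v set \<Rightarrow> 'v set" where
  "qadd N t u = cls N (rep t + rep u)"

definition qscale ::
    "('x \<Rightarrow>\<^sub>0 'k) set \<Rightarrow> 'k::field \<Rightarrow> ('x \<Rightarrow>\<^sub>0 'k) set \<Rightarrow> ('x \<Rightarrow>\<^sub>0 'k) set" where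
  "qscale N c t = cls N (fscale c (rep t))"

lemma cls_eq_iff:
  assumes "free.subspace N"
  shows "cls N f = cls N g \<longleftrightarrow> f - g \<in> N"
proof
  assume "cls N f = cls N g"
  moreover have "f \<in> cls N f"
    using free.subspace_0[OF assms] by (simp add: cls_def)
  ultimately show "f - g \<in> N" by (simp add: cls_def)
next
  assume fg: "f - g \<in> N"
  have "x - f \<in> N \<longleftrightarrow> x - g \<in> N" for x
    using free.subspace_add[OF assms, of "x - f" "f - g"]
      free.subspace_diff[OF assms, of "x - g" "f - g"] fg by auto
  then show "cls N f = cls N g" by (auto simp: cls_def)
qed

lemma rep_cls:
  assumes "free.subspace N"
  shows "rep (cls N f) - f \<in> N"
proof -
  have "f \<in> cls N f"
    using free.subspace_0[OF assms] by (simp add: cls_def)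
  then have "rep (cls N f) \<in> cls N f" unfolding rep_def by (rule someI)
  then show ?thesis by (simp add: cls_def)
qed


section \<open>Tensor products\<close>

text \<open>\<open>slot_rel s \<phi>\<close> are the relators that make \<open>x \<mapsto> gen (\<phi> x)\<close> linear. The tensor powers
  \<open>H \<otimes> H\<close> and \<open>H \<otimes> H \<otimes> H\<close> over the field are \<open>quot (null2 s)\<close> and \<open>quot (null3 s)\<close>;
  the threefold product is taken without brackets, so that no associator is needed.\<close>

definition slot_rel ::
    "('k::field \<Rightarrow> 'h::ab_group_add \<Rightarrow> 'h) \<Rightarrow> ('h \<Rightarrow> 'x) \<Rightarrow> ('x \<Rightarrow>\<^sub>0 'k) set" where
  "slot_rel s \<phi> = {gen (\<phi> (x + y)) - gen (\<phi> x) - gen (\<phi> y) | x y. True}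
     \<union> {gen (\<phi> (s c x)) - fscale c (gen (\<phi> x)) | c x. True}"

definition rel2 :: "('k::field \<Rightarrow> 'h::ab_group_add \<Rightarrow> 'h) \<Rightarrow> ('h \<times> 'h \<Rightarrow>\<^sub>0 'k) set" where
  "rel2 s = (\<Union>y. slot_rel s (\<lambda>x. (x, y))) \<union> (\<Union>x. slot_rel s (\<lambda>y. (x, y)))"

definition rel3 :: "('k::field \<Rightarrow> 'h::ab_group_add \<Rightarrow> 'h) \<Rightarrow> ('h \<times> 'h \<times> 'h \<Rightarrow>\<^sub>0 'k) set" where
  "rel3 s = (\<Union>y z. slot_rel s (\<lambda>x. (x, y, z))) \<union> (\<Union>x z. slot_rel s (\<lambda>y. (x, y, z)))
     \<union> (\<Union>x y. slot_rel s (\<lambda>z. (x, y, z)))"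

definition null2 :: "('k::field \<Rightarrow> 'h::ab_group_add \<Rightarrow> 'h) \<Rightarrow> ('h \<times> 'h \<Rightarrow>\<^sub>0 'k) set" where
  "null2 s = free.span (rel2 s)"

definition null3 :: "('k::field \<Rightarrow> 'h::ab_group_add \<Rightarrow> 'h) \<Rightarrow> ('h \<times> 'h \<times> 'h \<Rightarrow>\<^sub>0 'k) set" where
  "null3 s = free.span (rel3 s)"

text \<open>For an algebra with carrier \<open>A\<close> acting on \<open>H\<close> from the left by \<open>la\<close> and from the right by
  \<open>ra\<close>, compatibly with the scalars, \<open>H \<otimes>\<^sub>A H\<close> and \<open>H \<otimes>\<^sub>A H \<otimes>\<^sub>A H\<close> are \<open>quot (bnull2 s A la ra)\<close>
  and \<open>quot (bnull3 s A la ra)\<close>.\<close>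

definition bnull2 :: "('k::field \<Rightarrow> 'h::ab_group_add \<Rightarrow> 'h) \<Rightarrow> 'a set \<Rightarrow>
    ('a \<Rightarrow> 'h \<Rightarrow> 'h) \<Rightarrow> ('h \<Rightarrow> 'a \<Rightarrow> 'h) \<Rightarrow> ('h \<times> 'h \<Rightarrow>\<^sub>0 'k) set" where
  "bnull2 s A la ra =
     free.span (rel2 s \<union> {gen (ra x a, y) - gen (x, la a y) | x a y. a \<in> A})"

definition bnull3 :: "('k::field \<Rightarrow> 'h::ab_group_add \<Rightarrow> 'h) \<Rightarrow> 'a set \<Rightarrow>
    ('a \<Rightarrow> 'h \<Rightarrow> 'h) \<Rightarrow> ('h \<Rightarrow> 'a \<Rightarrow> 'h) \<Rightarrow> ('h \<times> 'h \<times> 'h \<Rightarrow>\<^sub>0 'k) set" where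
  "bnull3 s A la ra =
     free.span (rel3 s \<union> {gen (ra x a, y, z) - gen (x, la a y, z) | x a y z. a \<in> A}
                       \<union> {gen (x, ra y a, z) - gen (x, y, la a z) | x a y z. a \<in> A})"

text \<open>\<open>comult_id N D\<close> and \<open>id_comult N D\<close> are \<open>D \<otimes> id\<close> and \<open>id \<otimes> D\<close>. Their target is the
  threefold tensor product \<open>quot N\<close>, over the field or over \<open>A\<close> depending on \<open>N\<close>.\<close>

definition comult_id :: "('h \<times> 'h \<times> 'h \<Rightarrow>\<^sub>0 'k::field) set \<Rightarrow> ('h \<Rightarrow> ('h \<times> 'h \<Rightarrow>\<^sub>0 'k) set) \<Rightarrow>
    ('h \<times> 'h \<Rightarrow>\<^sub>0 'k) set \<Rightarrow> ('h \<times> 'h \<times> 'h \<Rightarrow>\<^sub>0 'k) set" where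
  "comult_id N D t =
     cls N (fext fscale (\<lambda>(x, y). fext fscale (\<lambda>(u, v). gen (u, v, y)) (rep (D x))) (rep t))"

definition id_comult :: "('h \<times> 'h \<times> 'h \<Rightarrow>\<^sub>0 'k::field) set \<Rightarrow> ('h \<Rightarrow> ('h \<times> 'h \<Rightarrow>\<^sub>0 'k) set) \<Rightarrow>
    ('h \<times> 'h \<Rightarrow>\<^sub>0 'k) set \<Rightarrow> ('h \<times> 'h \<times> 'h \<Rightarrow>\<^sub>0 'k) set" where
  "id_comult N D t =
     cls N (fext fscale (\<lambda>(x, y). fext fscale (\<lambda>(u, v). gen (x, u, v)) (rep (D y))) (rep t))"

definition tmult2 :: "('k::field \<Rightarrow> 'h::ring \<Rightarrow> 'h) \<Rightarrow>
    ('h \<times> 'h \<Rightarrow>\<^sub>0 'k) set \<Rightarrow> ('h \<times> 'h \<Rightarrow>\<^sub>0 'k) set \<Rightarrow> ('h \<times> 'h \<Rightarrow>\<^sub>0 'k) set" where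
  "tmult2 s t u = cls (null2 s)
     (fext fscale (\<lambda>(x, y). fext fscale (\<lambda>(x', y'). gen (x * x', y * y')) (rep u)) (rep t))"

definition tmult3 :: "('k::field \<Rightarrow> 'h::ring \<Rightarrow> 'h) \<Rightarrow>
    ('h \<times> 'h \<times> 'h \<Rightarrow>\<^sub>0 'k) set \<Rightarrow> ('h \<times> 'h \<times> 'h \<Rightarrow>\<^sub>0 'k) set \<Rightarrow> ('h \<times> 'h \<times> 'h \<Rightarrow>\<^sub>0 'k) set" where
  "tmult3 s t u = cls (null3 s)
     (fext fscale (\<lambda>(x, y, z).
        fext fscale (\<lambda>(x', y', z'). gen (x * x', y * y', z * z')) (rep u)) (rep t))"


section \<open>Weak bialgebras\<close>

text \<open>The sort \<open>{ring, monoid_mult}\<close> (unital rings) is used in place of \<open>ring_1\<close> so that the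
  zero algebra is not excluded.\<close>

locale unital_algebra = vector_space scale
  for scale :: "'k::field \<Rightarrow> 'h::{ring,monoid_mult} \<Rightarrow> 'h" +
  assumes scale_mult_left: "scale c x * y = scale c (x * y)"
    and scale_mult_right: "x * scale c y = scale c (x * y)"

text \<open>Up to \<open>tmult2_pure\<close>: the product of \<open>H \<otimes> H\<close> is independent of representatives and is the
  usual one on pure tensors.\<close>

lemma fext_span:
  assumes "free.subspace N" "\<And>r. r \<in> R \<Longrightarrow> fext fscale g r \<in> N" "f \<in> free.span R"
  shows "fext fscale g f \<in> N"
proof -
  interpret L: Vector_Spaces.linear fscale fscale "fext fscale g"
    by (rule linear_fext) (rule free.vector_space_axioms)
  show ?thesis
    using assms(3)
  proof (induction rule: free.span_induct)
    case base
    show ?case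
      using assms(1) by (auto simp: free.subspace_def L.zero L.add L.scale)
  qed (use assms in auto)
qed

lemma fext_fgen: "fext fscale g (gen p) = (g p :: _ \<Rightarrow>\<^sub>0 'k::field)"
  by (rule fext_gen) (rule free.vector_space_axioms)

lemma lin_fext: "Vector_Spaces.linear fscale fscale (fext fscale g)"
  by (rule linear_fext) (rule free.vector_space_axioms)

lemmas fext_lin =
  module_hom.add[OF lin_fext[folded module_hom_iff_linear]]
  module_hom.diff[OF lin_fext[folded module_hom_iff_linear]]
  module_hom.scale[OF lin_fext[folded module_hom_iff_linear]]

lemma null2_gens:
  "gen (x+x',y) - gen (x,y) - gen (x',y) \<in> null2 s"
  "gen (s c x,y) - fscale c (gen (x,y)) \<in> null2 s"
  "gen (x,y+y') - gen (x,y) - gen (x,y') \<in> null2 s"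
  "gen (x,s c y) - fscale c (gen (x,y)) \<in> null2 s"
  unfolding null2_def by (rule free.span_base; force simp: rel2_def slot_rel_def)+

lemma null2_sub: "free.subspace (null2 s)"
  unfolding null2_def by simp

context unital_algebra begin

lemma null2_mult_left:
  assumes "f \<in> null2 scale"
  shows "fext fscale (\<lambda>(x', y'). gen (x * x', y * y')) f \<in> null2 scale"
  by (rule fext_span[OF null2_sub _ assms[unfolded null2_def]])
   (auto simp: rel2_def slot_rel_def fext_lin fext_fgen distrib_left scale_mult_right null2_gens)

lemma fext_diff_fun: "fext fscale g f - fext fscale h f = fext fscale (\<lambda>p. g p - h p) f"
  by (simp add: fext_def sum_subtractf free.scale_right_diff_distrib)

lemma fext_scale_fun: "fscale c (fext fscale h f) = fext fscale (\<lambda>p. fscale c (h p)) f"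
  by (simp add: fext_def free.scale_sum_right mult.commute)

lemma fext_in:
  assumes "free.subspace N" "\<And>p. g p \<in> N" shows "fext fscale g f \<in> N"
  unfolding fext_def using assms by (intro free.subspace_sum) (auto simp: free.subspace_scale)

lemma null2_mult_right:
  assumes "f \<in> null2 scale"
  shows "fext fscale (\<lambda>(x, y). fext fscale (\<lambda>(x', y'). gen (x * x', y * y')) g) f \<in> null2 scale"
  by (rule fext_span[OF null2_sub _ assms[unfolded null2_def]])
   (auto simp: rel2_def slot_rel_def fext_lin fext_fgen fext_diff_fun fext_scale_fun
     distrib_right scale_mult_left case_prod_beta,
    auto intro!: fext_in[OF null2_sub] null2_gens)

lemma tmult2_cls:
  "tmult2 scale (cls (null2 scale) f) (cls (null2 scale) g) =
   cls (null2 scale) (fext fscale (\<lambda>(x, y). fext fscale (\<lambda>(x', y'). gen (x * x', y * y')) g) f)"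
proof -
  let ?f = "rep (cls (null2 scale) f)" and ?g = "rep (cls (null2 scale) g)"
  let ?F = "\<lambda>f g. fext fscale (\<lambda>(x, y). fext fscale (\<lambda>(x', y'). gen (x * x', y * y')) g) f"
  have "?F ?f ?g - ?F f ?g \<in> null2 scale"
    using null2_mult_right[OF rep_cls[OF null2_sub]] by (simp add: fext_lin)
  moreover have "?F f ?g - ?F f g \<in> null2 scale"
    using null2_mult_left[OF rep_cls[OF null2_sub]]
    by (auto simp: fext_diff_fun fext_lin intro!: fext_in null2_sub)
  ultimately have "?F ?f ?g - ?F f g \<in> null2 scale"
    using free.subspace_add[OF null2_sub] by fastforce
  then show ?thesis unfolding tmult2_def by (simp add: cls_eq_iff null2_sub)
qed

lemma tmult2_pure: "tmult2 scale (cls (null2 scale) (gen (x,y))) (cls (null2 scale) (gen (u,v))) =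
  cls (null2 scale) (gen (x * u, y * v))"
  by (simp add: tmult2_cls fext_fgen)

end

locale weak_bialgebra = unital_algebra scale
  for scale :: "'k::field \<Rightarrow> 'h::{ring,monoid_mult} \<Rightarrow> 'h" +
  fixes Delta :: "'h \<Rightarrow> ('h \<times> 'h \<Rightarrow>\<^sub>0 'k) set"
    and eps :: "'h \<Rightarrow> 'k"
  assumes Delta_in: "Delta x \<in> quot (null2 scale)"
    and Delta_add: "Delta (x + y) = qadd (null2 scale) (Delta x) (Delta y)"
    and Delta_scale: "Delta (scale c x) = qscale (null2 scale) c (Delta x)"
    and eps_linear: "Vector_Spaces.linear scale (*) eps"
    and coassoc: "comult_id (null3 scale) Delta (Delta x) = id_comult (null3 scale) Delta (Delta x)"
    and counit_left: "fext scale (\<lambda>(u, v). scale (eps u) v) (rep (Delta x)) = x"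
    and counit_right: "fext scale (\<lambda>(u, v). scale (eps v) u) (rep (Delta x)) = x"
    and Delta_mult: "Delta (x * y) = tmult2 scale (Delta x) (Delta y)"
    and eps_mult_12: "eps (x * y * z) = fext (*) (\<lambda>(u, v). eps (x * u) * eps (v * z)) (rep (Delta y))"
    and eps_mult_21: "eps (x * y * z) = fext (*) (\<lambda>(u, v). eps (x * v) * eps (u * z)) (rep (Delta y))"
    and Delta_one_12: "comult_id (null3 scale) Delta (Delta 1) =
      tmult3 scale (cls (null3 scale) (fext fscale (\<lambda>(u, v). gen (u, v, 1)) (rep (Delta 1))))
                   (cls (null3 scale) (fext fscale (\<lambda>(u, v). gen (1, u, v)) (rep (Delta 1))))"
    and Delta_one_21: "comult_id (null3 scale) Delta (Delta 1) =
      tmult3 scale (cls (null3 scale) (fext fscale (\<lambda>(u, v). gen (1, u, v)) (rep (Delta 1))))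
                   (cls (null3 scale) (fext fscale (\<lambda>(u, v). gen (u, v, 1)) (rep (Delta 1))))"

definition PiL :: "('k::field \<Rightarrow> 'h::{ring,monoid_mult} \<Rightarrow> 'h) \<Rightarrow>
    ('h \<Rightarrow> ('h \<times> 'h \<Rightarrow>\<^sub>0 'k) set) \<Rightarrow> ('h \<Rightarrow> 'k) \<Rightarrow> 'h \<Rightarrow> 'h" where
  "PiL s Delta eps x = fext s (\<lambda>(u, v). s (eps (u * x)) v) (rep (Delta 1))"

definition PiLbar :: "('k::field \<Rightarrow> 'h::{ring,monoid_mult} \<Rightarrow> 'h) \<Rightarrow>
    ('h \<Rightarrow> ('h \<times> 'h \<Rightarrow>\<^sub>0 'k) set) \<Rightarrow> ('h \<Rightarrow> 'k) \<Rightarrow> 'h \<Rightarrow> 'h" where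
  "PiLbar s Delta eps x = fext s (\<lambda>(u, v). s (eps (v * x)) u) (rep (Delta 1))"


section \<open>Bialgebroids with balancing subalgebra\<close>

text \<open>The base algebra \<open>A\<close> is a unital subalgebra of an algebra on the type \<open>'a\<close> (\<open>A = UNIV\<close> is
  allowed, so every algebra is covered). Functions with domain \<open>A\<close> are functions on \<open>'a\<close> whose
  values outside \<open>A\<close> play no role.\<close>

locale base_algebra = unital_algebra scaleA
  for scaleA :: "'k::field \<Rightarrow> 'a::{ring,monoid_mult} \<Rightarrow> 'a" +
  fixes A :: "'a set"
  assumes A_subspace: "subspace A"
    and A_one: "1 \<in> A"
    and A_mult: "\<lbrakk>a \<in> A; b \<in> A\<rbrakk> \<Longrightarrow> a * b \<in> A"

locale coring = base_algebra scaleA A + H: vector_space scale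
  for scaleA :: "'k::field \<Rightarrow> 'a::{ring,monoid_mult} \<Rightarrow> 'a"
    and A :: "'a set"
    and scale :: "'k \<Rightarrow> 'h::ab_group_add \<Rightarrow> 'h" +
  fixes la :: "'a \<Rightarrow> 'h \<Rightarrow> 'h"
    and ra :: "'h \<Rightarrow> 'a \<Rightarrow> 'h"
    and Delta' :: "'h \<Rightarrow> ('h \<times> 'h \<Rightarrow>\<^sub>0 'k) set"
    and eps' :: "'h \<Rightarrow> 'a"
  assumes la_linear: "a \<in> A \<Longrightarrow> Vector_Spaces.linear scale scale (la a)"
    and la_add: "\<lbrakk>a \<in> A; b \<in> A\<rbrakk> \<Longrightarrow> la (a + b) h = la a h + la b h"
    and la_scale: "a \<in> A \<Longrightarrow> la (scaleA c a) h = scale c (la a h)"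
    and la_one: "la 1 h = h"
    and la_mult: "\<lbrakk>a \<in> A; b \<in> A\<rbrakk> \<Longrightarrow> la (a * b) h = la a (la b h)"
    and ra_linear: "a \<in> A \<Longrightarrow> Vector_Spaces.linear scale scale (\<lambda>h. ra h a)"
    and ra_add: "\<lbrakk>a \<in> A; b \<in> A\<rbrakk> \<Longrightarrow> ra h (a + b) = ra h a + ra h b"
    and ra_scale: "a \<in> A \<Longrightarrow> ra h (scaleA c a) = scale c (ra h a)"
    and ra_one: "ra h 1 = h"
    and ra_mult: "\<lbrakk>a \<in> A; b \<in> A\<rbrakk> \<Longrightarrow> ra h (a * b) = ra (ra h a) b"
    and la_ra: "\<lbrakk>a \<in> A; b \<in> A\<rbrakk> \<Longrightarrow> ra (la a h) b = la a (ra h b)"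
    and Delta'_in: "Delta' h \<in> quot (bnull2 scale A la ra)"
    and Delta'_add: "Delta' (g + h) = qadd (bnull2 scale A la ra) (Delta' g) (Delta' h)"
    and Delta'_scale: "Delta' (scale c h) = qscale (bnull2 scale A la ra) c (Delta' h)"
    and Delta'_la: "a \<in> A \<Longrightarrow> Delta' (la a h) =
      cls (bnull2 scale A la ra) (fext fscale (\<lambda>(x, y). gen (la a x, y)) (rep (Delta' h)))"
    and Delta'_ra: "a \<in> A \<Longrightarrow> Delta' (ra h a) =
      cls (bnull2 scale A la ra) (fext fscale (\<lambda>(x, y). gen (x, ra y a)) (rep (Delta' h)))"
    and coassoc': "comult_id (bnull3 scale A la ra) Delta' (Delta' h) =
      id_comult (bnull3 scale A la ra) Delta' (Delta' h)"
    and eps'_in: "eps' h \<in> A"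
    and eps'_linear: "Vector_Spaces.linear scale scaleA eps'"
    and eps'_la: "a \<in> A \<Longrightarrow> eps' (la a h) = a * eps' h"
    and eps'_ra: "a \<in> A \<Longrightarrow> eps' (ra h a) = eps' h * a"
    and counit'_left: "fext scale (\<lambda>(x, y). la (eps' x) y) (rep (Delta' h)) = h"
    and counit'_right: "fext scale (\<lambda>(x, y). ra x (eps' y)) (rep (Delta' h)) = h"

locale source_target_ring = base_algebra scaleA A + H: unital_algebra scale
  for scaleA :: "'k::field \<Rightarrow> 'a::{ring,monoid_mult} \<Rightarrow> 'a"
    and A :: "'a set"
    and scale :: "'k \<Rightarrow> 'h::{ring,monoid_mult} \<Rightarrow> 'h" +
  fixes \<alpha> :: "'a \<Rightarrow> 'h"
    and \<beta> :: "'a \<Rightarrow> 'h"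
  assumes source_add: "\<lbrakk>a \<in> A; b \<in> A\<rbrakk> \<Longrightarrow> \<alpha> (a + b) = \<alpha> a + \<alpha> b"
    and source_scale: "a \<in> A \<Longrightarrow> \<alpha> (scaleA c a) = scale c (\<alpha> a)"
    and source_one: "\<alpha> 1 = 1"
    and source_mult: "\<lbrakk>a \<in> A; b \<in> A\<rbrakk> \<Longrightarrow> \<alpha> (a * b) = \<alpha> a * \<alpha> b"
    and target_add: "\<lbrakk>a \<in> A; b \<in> A\<rbrakk> \<Longrightarrow> \<beta> (a + b) = \<beta> a + \<beta> b"
    and target_scale: "a \<in> A \<Longrightarrow> \<beta> (scaleA c a) = scale c (\<beta> a)"
    and target_one: "\<beta> 1 = 1"
    and target_mult: "\<lbrakk>a \<in> A; b \<in> A\<rbrakk> \<Longrightarrow> \<beta> (a * b) = \<beta> b * \<beta> a"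
    and source_target_commute: "\<lbrakk>a \<in> A; b \<in> A\<rbrakk> \<Longrightarrow> \<alpha> a * \<beta> b = \<beta> b * \<alpha> a"

text \<open>The balanced tensor product for the bimodule structure \<open>a.h.b = \<alpha>(a)\<beta>(b)h\<close>, the projection
  \<open>\<pi> : H \<otimes> H \<rightarrow> H \<otimes>\<^sub>A H\<close>, and its kernel. The zero of \<open>quot N\<close> is \<open>cls N 0\<close>.\<close>

definition st_null2 :: "('k::field \<Rightarrow> 'h::ring \<Rightarrow> 'h) \<Rightarrow> 'a set \<Rightarrow> ('a \<Rightarrow> 'h) \<Rightarrow> ('a \<Rightarrow> 'h) \<Rightarrow>
    ('h \<times> 'h \<Rightarrow>\<^sub>0 'k) set" where
  "st_null2 s A \<alpha> \<beta> = bnull2 s A (\<lambda>a h. \<alpha> a * h) (\<lambda>h b. \<beta> b * h)"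

definition st_proj :: "('k::field \<Rightarrow> 'h::ring \<Rightarrow> 'h) \<Rightarrow> 'a set \<Rightarrow> ('a \<Rightarrow> 'h) \<Rightarrow> ('a \<Rightarrow> 'h) \<Rightarrow>
    ('h \<times> 'h \<Rightarrow>\<^sub>0 'k) set \<Rightarrow> ('h \<times> 'h \<Rightarrow>\<^sub>0 'k) set" where
  "st_proj s A \<alpha> \<beta> t = cls (st_null2 s A \<alpha> \<beta>) (rep t)"

definition st_ker :: "('k::field \<Rightarrow> 'h::ring \<Rightarrow> 'h) \<Rightarrow> 'a set \<Rightarrow> ('a \<Rightarrow> 'h) \<Rightarrow> ('a \<Rightarrow> 'h) \<Rightarrow>
    ('h \<times> 'h \<Rightarrow>\<^sub>0 'k) set set" where
  "st_ker s A \<alpha> \<beta> = {t \<in> quot (null2 s). st_proj s A \<alpha> \<beta> t = cls (st_null2 s A \<alpha> \<beta>) 0}"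

definition tensor_subspace :: "('k::field \<Rightarrow> 'h::ring \<Rightarrow> 'h) \<Rightarrow> ('h \<times> 'h \<Rightarrow>\<^sub>0 'k) set set \<Rightarrow> bool" where
  "tensor_subspace s B \<longleftrightarrow> B \<subseteq> quot (null2 s) \<and> cls (null2 s) 0 \<in> B \<and>
     (\<forall>t\<in>B. \<forall>u\<in>B. qadd (null2 s) t u \<in> B) \<and> (\<forall>c. \<forall>t\<in>B. qscale (null2 s) c t \<in> B)"

definition tensor_subalgebra :: "('k::field \<Rightarrow> 'h::ring \<Rightarrow> 'h) \<Rightarrow> ('h \<times> 'h \<Rightarrow>\<^sub>0 'k) set set \<Rightarrow> bool" where
  "tensor_subalgebra s B \<longleftrightarrow> tensor_subspace s B \<and> (\<forall>t\<in>B. \<forall>u\<in>B. tmult2 s t u \<in> B)"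

definition two_sided_ideal_in :: "('k::field \<Rightarrow> 'h::ring \<Rightarrow> 'h) \<Rightarrow>
    ('h \<times> 'h \<Rightarrow>\<^sub>0 'k) set set \<Rightarrow> ('h \<times> 'h \<Rightarrow>\<^sub>0 'k) set set \<Rightarrow> bool" where
  "two_sided_ideal_in s J B \<longleftrightarrow> J \<subseteq> B \<and> tensor_subspace s J \<and>
     (\<forall>t\<in>J. \<forall>u\<in>B. tmult2 s t u \<in> J \<and> tmult2 s u t \<in> J)"

text \<open>\<open>act\<close> makes the vector space \<open>A\<close> a unital left module over the algebra \<open>H\<close>.\<close>

definition left_action :: "('k::field \<Rightarrow> 'h::{ring,monoid_mult} \<Rightarrow> 'h) \<Rightarrow>
    ('k \<Rightarrow> 'a::ab_group_add \<Rightarrow> 'a) \<Rightarrow> 'a set \<Rightarrow> ('h \<Rightarrow> 'a \<Rightarrow> 'a) \<Rightarrow> bool" where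
  "left_action s sA A act \<longleftrightarrow>
     (\<forall>h. \<forall>a\<in>A. act h a \<in> A) \<and>
     (\<forall>g h. \<forall>a\<in>A. act (g + h) a = act g a + act h a) \<and>
     (\<forall>h. \<forall>a\<in>A. \<forall>b\<in>A. act h (a + b) = act h a + act h b) \<and>
     (\<forall>c h. \<forall>a\<in>A. act (s c h) a = sA c (act h a) \<and> act h (sA c a) = sA c (act h a)) \<and>
     (\<forall>a\<in>A. act 1 a = a) \<and>
     (\<forall>g h. \<forall>a\<in>A. act (g * h) a = act g (act h a))"

text \<open>The coring is formed with the bimodule structure \<open>a.h.b = \<alpha>(a)\<beta>(b)h\<close>.
  In \<open>C3Mb_mult\<close>, the product of two classes of \<open>\<B>/(I \<inter> \<B>)\<close>, viewed in \<open>\<pi>(\<B>)\<close>, is the image under \<open>\<pi>\<close>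
  of the product of any two of their representatives in \<open>\<B>\<close>.\<close>

locale left_bialgebroid_with_balancing =
  source_target_ring scaleA A scale \<alpha> \<beta> +
  coring scaleA A scale "\<lambda>a h. \<alpha> a * h" "\<lambda>h b. \<beta> b * h" Delta' eps'
  for scaleA :: "'k::field \<Rightarrow> 'a::{ring,monoid_mult} \<Rightarrow> 'a"
    and A :: "'a set"
    and scale :: "'k \<Rightarrow> 'h::{ring,monoid_mult} \<Rightarrow> 'h"
    and \<alpha> \<beta> :: "'a \<Rightarrow> 'h"
    and Delta' :: "'h \<Rightarrow> ('h \<times> 'h \<Rightarrow>\<^sub>0 'k) set"
    and eps' :: "'h \<Rightarrow> 'a" +
  fixes B :: "('h \<times> 'h \<Rightarrow>\<^sub>0 'k) set set"
  assumes B_subalgebra: "tensor_subalgebra scale B"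
    and C2: "left_action scale scaleA A (\<lambda>h a. eps' (h * \<alpha> a))"
    and C3MI: "two_sided_ideal_in scale (st_ker scale A \<alpha> \<beta> \<inter> B) B"
    and C3Ma: "range Delta' \<subseteq> st_proj scale A \<alpha> \<beta> ` B"
    and C3Mb_mult: "\<lbrakk>t \<in> B; u \<in> B;
        st_proj scale A \<alpha> \<beta> t = Delta' g; st_proj scale A \<alpha> \<beta> u = Delta' h\<rbrakk> \<Longrightarrow>
      Delta' (g * h) = st_proj scale A \<alpha> \<beta> (tmult2 scale t u)"
    and C3Mb_one: "Delta' 1 = cls (st_null2 scale A \<alpha> \<beta>) (gen (1, 1))"

definition corner :: "('k::field \<Rightarrow> 'h::{ring,monoid_mult} \<Rightarrow> 'h) \<Rightarrow>
    ('h \<Rightarrow> ('h \<times> 'h \<Rightarrow>\<^sub>0 'k) set) \<Rightarrow> ('h \<times> 'h \<Rightarrow>\<^sub>0 'k) set set" where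
  "corner s Delta = {tmult2 s (tmult2 s (Delta 1) t) (Delta 1) | t. t \<in> quot (null2 s)}"

end

theory Submission
  imports Defs
begin

text \<open>Over a field, an identity in a tensor product holds as soon as all multilinear forms (for
  \<open>\<otimes>\<^sub>A\<close>: all balanced ones) agree on both sides. Sweedler notation thus becomes literal:
  \<open>sw x b\<close> is \<open>b(x\<^sub>1, x\<^sub>2)\<close> for a bilinear form \<open>b\<close>, and all computations take place in the field.

  The decisive identity is \<open>\<Delta>(1)(\<beta>(a) \<otimes> 1) = \<Delta>(1)(1 \<otimes> a)\<close> for \<open>a \<in> A\<close>. It shows that left multiplication
  by \<open>\<Delta>(1)\<close> kills the kernel of \<open>\<pi>\<close>. As it is the identity on the corner \<open>\<B>\<close>, the projection is injective
  on \<open>\<B>\<close>, the ideal \<open>I\<^sub>A \<inter> \<B>\<close> is zero, and multiplicativity of \<open>\<Delta>'\<close> is that of \<open>\<Delta>\<close>.\<close>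

section \<open>Testing tensors on forms\<close>

lemma vector_space_field: "vector_space ((*) :: 'k::field \<Rightarrow> 'k \<Rightarrow> 'k)"
  by unfold_locales (auto simp: algebra_simps)

text \<open>Adding \<open>x\<close> to a basis \<open>B\<close> of the span of \<open>R\<close>
  keeps it independent, so a functional may be prescribed as 1 at \<open>x\<close> and 0 on
  \<open>B\<close>.\<close>

lemma (in vector_space) functional_off_span:
  assumes "x \<notin> span R"
  obtains \<phi> where "Vector_Spaces.linear scale (*) \<phi>" "\<And>r. r \<in> R \<Longrightarrow> \<phi> r = 0" "\<phi> x = 1"
proof -
  interpret P: vector_space_pair scale "(*) :: 'a \<Rightarrow> 'a \<Rightarrow> 'a"
    by (intro vector_space_pair.intro vector_space_axioms vector_space_field)
  obtain B where B: "B \<subseteq> R" "independent B" "R \<subseteq> span B"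
    using maximal_independent_subset[of R] by blast
  have x: "x \<notin> span B"
    using assms span_mono[OF B(1)] by blast
  then have "independent (insert x B)"
    using B(2) independent_insertI by blast
  from P.linear_independent_extend[OF this, of "\<lambda>y. if y = x then 1 else 0"]
  obtain \<phi> where \<phi>: "Vector_Spaces.linear scale (*) \<phi>"
    and v: "\<And>y. y \<in> insert x B \<Longrightarrow> \<phi> y = (if y = x then 1 else 0)" by blast
  have "\<phi> b = 0" if "b \<in> B" for b
    using v[of b] that x span_base by auto
  then have "\<phi> r = 0" if "r \<in> R" for r
    using P.linear_eq_0_on_span[OF \<phi>, of B r] that B(3) by blast
  then show thesis
    using that \<phi> v[of x] by simp
qed

section \<open>Linear forms on free spaces and their descent to quotients\<close>

definition form_of :: "('x \<Rightarrow> 'k::field) \<Rightarrow> ('x \<Rightarrow>\<^sub>0 'k) \<Rightarrow> 'k" where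
  "form_of = fext (*)"

lemma linear_form_of: "Vector_Spaces.linear fscale (*) (form_of b)"
  unfolding form_of_def by (rule linear_fext[OF vector_space_field])

lemma form_of_gen [simp]: "form_of b (gen p) = b p"
  unfolding form_of_def by (rule fext_gen[OF vector_space_field])

lemmas form_of_linear [simp] =
  module_hom.zero[OF linear_form_of[folded module_hom_iff_linear]]
  module_hom.add[OF linear_form_of[folded module_hom_iff_linear]]
  module_hom.diff[OF linear_form_of[folded module_hom_iff_linear]]
  module_hom.scale[OF linear_form_of[folded module_hom_iff_linear]]

lemma linear_of_fext:
  assumes "Vector_Spaces.linear s s' \<phi>"
  shows "\<phi> (fext s g f) = fext s' (\<lambda>p. \<phi> (g p)) f"
proof -
  interpret Vector_Spaces.linear s s' \<phi> by fact
  show ?thesis by (simp add: fext_def sum scale)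
qed

lemma form_of_fext [simp]: "form_of b (fext fscale g f) = form_of (\<lambda>p. form_of b (g p)) f"
  using linear_of_fext[OF linear_form_of] by (simp add: form_of_def)

lemma form_of_linear_functional:
  assumes "Vector_Spaces.linear fscale (*) \<phi>"
  shows "\<phi> f = form_of (\<lambda>p. \<phi> (gen p)) f"
proof -
  have "f = fext fscale gen f"
    by (rule poly_mapping_eqI)
      (auto simp: fext_def lookup_sum lookup_single when_def in_keys_iff
        if_distrib[of "(*) _"] cong: if_cong)
  then show ?thesis
    using linear_of_fext[OF assms, of gen f] by (simp add: form_of_def)
qed

text \<open>These are exactly the forms that factor through the quotient by the span of
  \<open>R\<close>.\<close>

definition kills :: "('x \<Rightarrow> 'k::field) \<Rightarrow> ('x \<Rightarrow>\<^sub>0 'k) set \<Rightarrow> bool" where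
  "kills b R \<longleftrightarrow> (\<forall>r\<in>R. form_of b r = 0)"

lemma kills_span:
  assumes "kills b R" "f \<in> free.span R"
  shows "form_of b f = 0"
proof -
  interpret L: Vector_Spaces.linear fscale "(*)" "form_of b" by (rule linear_form_of)
  show ?thesis
    using assms L.eq_0_on_span by (auto simp: kills_def)
qed

text \<open>A subspace is the common kernel of the functionals vanishing on it. On a free space
  every functional is some \<open>form_of b\<close>, so quantifying over \<open>b\<close> loses none
  of them.\<close>

lemma in_span_iff_forms: "f \<in> free.span R \<longleftrightarrow> (\<forall>b. kills b R \<longrightarrow> form_of b f = 0)"
proof (rule iffI; (intro allI impI)?)
  assume *: "\<forall>b. kills b R \<longrightarrow> form_of b f = 0"
  show "f \<in> free.span R"
  proof (rule ccontr)
    assume "f \<notin> free.span R"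
    then obtain \<phi> where \<phi>: "Vector_Spaces.linear fscale (*) \<phi>"
      "\<And>r. r \<in> R \<Longrightarrow> \<phi> r = 0" "\<phi> f = 1"
      using free.functional_off_span by blast
    then show False
      using * form_of_linear_functional[OF \<phi>(1)] by (metis kills_def zero_neq_one)
  qed
qed (rule kills_span)

lemma cls_span_eq_iff:
  "cls (free.span R) f = cls (free.span R) g \<longleftrightarrow>
    (\<forall>b. kills b R \<longrightarrow> form_of b f = form_of b g)"
  by (simp add: cls_eq_iff in_span_iff_forms)

text \<open>A form that kills the relators is constant on cosets, so the arbitrary choice made by
  \<open>rep\<close> disappears once such a form is applied. Well-definedness below is settled in
  this way.\<close>

lemma form_of_rep_cls [simp]:
  assumes "kills b R"
  shows "form_of b (rep (cls (free.span R) f)) = form_of b f"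
  using kills_span[OF assms rep_cls[OF free.subspace_span]] by simp

lemma cls_rep:
  assumes "free.subspace N" "t \<in> quot N"
  shows "cls N (rep t) = t"
proof -
  obtain f where "t = cls N f" using assms(2) by (auto simp: quot_def)
  then show ?thesis using rep_cls[OF assms(1)] by (simp add: cls_eq_iff assms(1))
qed

lemma cls_in_quot [simp]: "cls N f \<in> quot N"
  by (simp add: quot_def)

section \<open>Evaluation of twofold and threefold tensors on curried forms\<close>

definition pair2 :: "('x \<times> 'y \<Rightarrow>\<^sub>0 'k::field) \<Rightarrow> ('x \<Rightarrow> 'y \<Rightarrow> 'k) \<Rightarrow> 'k" where
  "pair2 f b = form_of (\<lambda>(x, y). b x y) f"

lemma pair2_sum:
  "pair2 f b = (\<Sum>p\<in>Poly_Mapping.keys f. Poly_Mapping.lookup f p * b (fst p) (snd p))"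
  by (simp add: pair2_def form_of_def fext_def case_prod_beta)

lemma pair2_gen [simp]: "pair2 (gen (x, y)) b = b x y"
  by (simp add: pair2_def)

lemma pair2_zero [simp]: "pair2 f (\<lambda>x y. 0) = 0"
  by (simp add: pair2_sum)

lemma pair2_zero_left [simp]: "pair2 0 b = 0"
  by (simp add: pair2_sum)

lemma pair2_add_left [simp]: "pair2 (f + g) b = pair2 f b + pair2 g b"
  by (simp add: pair2_def)

lemma pair2_scale_left [simp]: "pair2 (fscale c f) b = c * pair2 f b"
  by (simp add: pair2_def)

lemma pair2_add [simp]: "pair2 f (\<lambda>x y. b x y + c x y) = pair2 f b + pair2 f c"
  by (simp add: pair2_sum distrib_left sum.distrib)

lemma pair2_cmult: "c * pair2 f b = pair2 f (\<lambda>x y. c * b x y)"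
  by (simp add: pair2_sum sum_distrib_left mult_ac)

lemma pair2_multc: "pair2 f b * c = pair2 f (\<lambda>x y. b x y * c)"
  using pair2_cmult[of c f b] by (simp add: mult.commute)

text \<open>An exchange of finite sums. In Sweedler notation: independent coproducts may be expanded
  in either order.\<close>

lemma pair2_swap:
  "pair2 f (\<lambda>x y. pair2 g (\<lambda>u v. b x y u v)) = pair2 g (\<lambda>u v. pair2 f (\<lambda>x y. b x y u v))"
  by (simp add: pair2_sum sum_distrib_left sum.swap[of _ "Poly_Mapping.keys f"] mult_ac)

lemma pair2_fext:
  "pair2 (fext fscale (\<lambda>(x, y). g x y) f) b = pair2 f (\<lambda>x y. pair2 (g x y) b)"
  by (simp add: pair2_def case_prod_unfold)

definition pair3 :: "('x \<times> 'y \<times> 'z \<Rightarrow>\<^sub>0 'k::field) \<Rightarrow> ('x \<Rightarrow> 'y \<Rightarrow> 'z \<Rightarrow> 'k) \<Rightarrow> 'k" where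
  "pair3 f t = form_of (\<lambda>(x, y, z). t x y z) f"

lemma pair3_gen [simp]: "pair3 (gen (x, y, z)) t = t x y z"
  by (simp add: pair3_def)

lemma pair3_fext2:
  "pair3 (fext fscale (\<lambda>(x, y). g x y) f) t = pair2 f (\<lambda>x y. pair3 (g x y) t)"
  by (simp add: pair3_def pair2_def case_prod_unfold)

lemma pair3_fext3:
  "pair3 (fext fscale (\<lambda>(x, y, z). g x y z) f) t = pair3 f (\<lambda>x y z. pair3 (g x y z) t)"
  by (simp add: pair3_def case_prod_unfold)

section \<open>Multilinear and balanced forms\<close>

definition lin1 :: "('k::field \<Rightarrow> 'h::ab_group_add \<Rightarrow> 'h) \<Rightarrow> ('h \<Rightarrow> 'k) \<Rightarrow> bool" where
  "lin1 s \<phi> \<longleftrightarrow> (\<forall>x y. \<phi> (x + y) = \<phi> x + \<phi> y) \<and> (\<forall>c x. \<phi> (s c x) = c * \<phi> x)"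

definition lin2 :: "('k::field \<Rightarrow> 'h::ab_group_add \<Rightarrow> 'h) \<Rightarrow> ('h \<Rightarrow> 'h \<Rightarrow> 'k) \<Rightarrow> bool" where
  "lin2 s b \<longleftrightarrow> (\<forall>y. lin1 s (\<lambda>x. b x y)) \<and> (\<forall>x. lin1 s (\<lambda>y. b x y))"

definition lin3 :: "('k::field \<Rightarrow> 'h::ab_group_add \<Rightarrow> 'h) \<Rightarrow> ('h \<Rightarrow> 'h \<Rightarrow> 'h \<Rightarrow> 'k) \<Rightarrow> bool" where
  "lin3 s t \<longleftrightarrow> (\<forall>y z. lin1 s (\<lambda>x. t x y z)) \<and> (\<forall>x z. lin1 s (\<lambda>y. t x y z)) \<and>
     (\<forall>x y. lin1 s (\<lambda>z. t x y z))"

lemma lin1D: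
  assumes "lin1 s \<phi>"
  shows "\<phi> (x + y) = \<phi> x + \<phi> y" "\<phi> (s c x) = c * \<phi> x"
  using assms by (auto simp: lin1_def)

lemma lin2D:
  assumes "lin2 s b"
  shows "b (x + y) z = b x z + b y z" "b (s c x) z = c * b x z"
    "b z (x + y) = b z x + b z y" "b z (s c x) = c * b z x"
  using assms by (auto simp: lin2_def lin1_def)

lemma lin3D:
  assumes "lin3 s t"
  shows "t (x + y) z w = t x z w + t y z w" "t (s c x) z w = c * t x z w"
    "t z (x + y) w = t z x w + t z y w" "t z (s c x) w = c * t z x w"
    "t z w (x + y) = t z w x + t z w y" "t z w (s c x) = c * t z w x"
  using assms by (auto simp: lin3_def lin1_def)

lemmas lin_defs = lin1_def lin2_def lin3_def

lemma kills_union [simp]: "kills b (R \<union> S) \<longleftrightarrow> kills b R \<and> kills b S"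
  by (auto simp: kills_def)

lemma kills_UN [simp]: "kills b (\<Union>i\<in>I. R i) \<longleftrightarrow> (\<forall>i\<in>I. kills b (R i))"
  by (auto simp: kills_def)

lemma kills_slot_rel [simp]: "kills b (slot_rel s p) \<longleftrightarrow> lin1 s (\<lambda>x. b (p x))"
proof
  assume *: "kills b (slot_rel s p)"
  have "b (p (x + y)) - b (p x) - b (p y) = 0" for x y
    using *[unfolded kills_def, rule_format, of "gen (p (x + y)) - gen (p x) - gen (p y)"]
    by (force simp: slot_rel_def)
  moreover have "b (p (s c x)) - c * b (p x) = 0" for c x
    using *[unfolded kills_def, rule_format, of "gen (p (s c x)) - fscale c (gen (p x))"]
    by (force simp: slot_rel_def)
  ultimately show "lin1 s (\<lambda>x. b (p x))" by (simp add: lin1_def algebra_simps)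
qed (auto simp: kills_def slot_rel_def lin1_def)

lemma kills_rel2 [simp]: "kills (\<lambda>(x, y). b x y) (rel2 s) \<longleftrightarrow> lin2 s b"
  by (simp add: rel2_def lin2_def)

lemma kills_rel3 [simp]: "kills (\<lambda>(x, y, z). t x y z) (rel3 s) \<longleftrightarrow> lin3 s t"
  by (auto simp: rel3_def lin3_def)

text \<open>These are the bilinear forms that factor through the tensor product over
  \<open>A\<close>; see \<open>kills_balanced2\<close>.\<close>

definition bal2 where
  "bal2 s A la ra b \<longleftrightarrow> lin2 s b \<and> (\<forall>a\<in>A. \<forall>x y. b (ra x a) y = b x (la a y))"

definition bal3 where
  "bal3 s A la ra t \<longleftrightarrow> lin3 s t \<and> (\<forall>a\<in>A. \<forall>x y z. t (ra x a) y z = t x (la a y) z) \<and>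
     (\<forall>a\<in>A. \<forall>x y z. t x (ra y a) z = t x y (la a z))"

lemma kills_balanced2 [simp]:
  "kills (\<lambda>(x, y). b x y) (rel2 s \<union> {gen (ra x a, y) - gen (x, la a y) | x a y. a \<in> A}) \<longleftrightarrow>
    bal2 s A la ra b"
proof -
  have "kills (\<lambda>(x, y). b x y) {gen (ra x a, y) - gen (x, la a y) | x a y. a \<in> A} \<longleftrightarrow>
    (\<forall>a\<in>A. \<forall>x y. b (ra x a) y = b x (la a y))"
    unfolding kills_def by (auto; force)
  then show ?thesis by (simp add: bal2_def)
qed

lemma kills_balanced3 [simp]:
  "kills (\<lambda>(x, y, z). t x y z) (rel3 s
      \<union> {gen (ra x a, y, z) - gen (x, la a y, z) | x a y z. a \<in> A}
      \<union> {gen (x, ra y a, z) - gen (x, y, la a z) | x a y z. a \<in> A}) \<longleftrightarrow>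
    bal3 s A la ra t"
proof -
  have "kills (\<lambda>(x, y, z). t x y z) {gen (ra x a, y, z) - gen (x, la a y, z) | x a y z. a \<in> A} \<longleftrightarrow>
    (\<forall>a\<in>A. \<forall>x y z. t (ra x a) y z = t x (la a y) z)"
    unfolding kills_def by (auto; force)
  moreover have "kills (\<lambda>(x, y, z). t x y z)
      {gen (x, ra y a, z) - gen (x, y, la a z) | x a y z. a \<in> A} \<longleftrightarrow>
    (\<forall>a\<in>A. \<forall>x y z. t x (ra y a) z = t x y (la a z))"
    unfolding kills_def by (auto; force)
  ultimately show ?thesis by (simp add: bal3_def)
qed

text \<open>\<open>kills_rel2\<close> and \<open>kills_balanced2\<close> recognise only forms
  written as a case distinction on pairs. Every form has that shape up to equality, so the
  quantifier can be restricted to it.\<close>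

lemma all_curry2: "(\<forall>b. P b) \<longleftrightarrow> (\<forall>b. P (\<lambda>(x, y). b x y))"
proof (safe)
  fix b assume "\<forall>b. P (\<lambda>(x, y). b x y)"
  from this[rule_format, of "curry b"] show "P b" by (simp add: curry_def)
qed auto

lemma all_curry3: "(\<forall>b. P b) \<longleftrightarrow> (\<forall>b. P (\<lambda>(x, y, z). b x y z))"
proof (safe)
  fix b assume "\<forall>b. P (\<lambda>(x, y, z). b x y z)"
  from this[rule_format, of "\<lambda>x y z. b (x, y, z)"] show "P b" by (simp add: case_prod_beta)
qed auto

section \<open>Equality of tensors tested on forms\<close>

lemma cls_null2_eq_iff:
  "cls (null2 s) f = cls (null2 s) g \<longleftrightarrow> (\<forall>b. lin2 s b \<longrightarrow> pair2 f b = pair2 g b)"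
  unfolding null2_def cls_span_eq_iff by (subst all_curry2) (simp add: pair2_def)

lemma cls_bnull2_eq_iff:
  "cls (bnull2 s A la ra) f = cls (bnull2 s A la ra) g \<longleftrightarrow>
    (\<forall>b. bal2 s A la ra b \<longrightarrow> pair2 f b = pair2 g b)"
  unfolding bnull2_def cls_span_eq_iff
  by (subst all_curry2) (simp only: kills_balanced2 pair2_def)

lemma cls_bnull3_eq_iff:
  "cls (bnull3 s A la ra) f = cls (bnull3 s A la ra) g \<longleftrightarrow>
    (\<forall>t. bal3 s A la ra t \<longrightarrow> pair3 f t = pair3 g t)"
  unfolding bnull3_def cls_span_eq_iff
  by (subst all_curry3) (simp only: kills_balanced3 pair3_def)

lemma pair2_rep_cls [simp]:
  assumes "lin2 s b"
  shows "pair2 (rep (cls (null2 s) f)) b = pair2 f b"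
  using assms unfolding pair2_def null2_def by (intro form_of_rep_cls) simp

lemma pair3_rep_cls [simp]:
  assumes "lin3 s t"
  shows "pair3 (rep (cls (null3 s) f)) t = pair3 f t"
  using assms unfolding pair3_def null3_def by (intro form_of_rep_cls) simp

lemma pair2_rep_bcls [simp]:
  assumes "bal2 s A la ra b"
  shows "pair2 (rep (cls (bnull2 s A la ra) f)) b = pair2 f b"
  using assms unfolding pair2_def bnull2_def
  by (intro form_of_rep_cls) (simp only: kills_balanced2)

lemma quot_null2_eqI:
  assumes "t \<in> quot (null2 s)" "u \<in> quot (null2 s)"
    and "\<And>b. lin2 s b \<Longrightarrow> pair2 (rep t) b = pair2 (rep u) b"
  shows "t = u"
proof -
  have "cls (null2 s) (rep t) = cls (null2 s) (rep u)"
    using assms(3) by (simp add: cls_null2_eq_iff)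
  then show ?thesis by (simp add: cls_rep null2_sub assms(1,2))
qed

text \<open>A nonzero difference lies outside the span of the empty set, so some functional detects
  it. Identities between vectors thereby reduce to identities in the field.\<close>

lemma (in vector_space) eq_if_lin1:
  assumes "\<And>\<phi>. lin1 scale \<phi> \<Longrightarrow> \<phi> x = \<phi> y"
  shows "x = y"
proof (rule ccontr)
  assume "x \<noteq> y"
  then have "x - y \<notin> span {}" by simp
  then obtain \<phi> where \<phi>: "Vector_Spaces.linear scale (*) \<phi>" "\<phi> (x - y) = 1"
    by (rule functional_off_span)
  interpret Vector_Spaces.linear scale "(*)" \<phi> by fact
  have "lin1 scale \<phi>" by (simp add: lin1_def add scale)
  from assms[OF this] \<phi>(2) show False by (simp add: diff)
qed

text \<open>\<open>lin1\<close> consists of bare equations, which simplification can check for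
  explicit forms. The vector space axioms bundled into \<open>Vector_Spaces.linear\<close> are
  supplied only here.\<close>

lemma lin1_linear:
  assumes "lin1 s \<phi>" "vector_space s"
  shows "Vector_Spaces.linear s (*) \<phi>"
proof -
  interpret vector_space s by fact
  show ?thesis
    using assms(1) by (subst Vector_Spaces.linear_iff)
      (simp add: lin1_def vector_space_axioms vector_space_field)
qed

lemma lin1_fext:
  assumes "lin1 s \<phi>" "vector_space s"
  shows "\<phi> (fext s (\<lambda>(x, y). g x y) f) = pair2 f (\<lambda>x y. \<phi> (g x y))"
  using linear_of_fext[OF lin1_linear[OF assms]]
  by (simp add: pair2_def form_of_def case_prod_unfold)


section \<open>Sweedler calculus\<close>

context weak_bialgebra
begin

section \<open>The weak bialgebra axioms in Sweedler form\<close>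

definition sw :: "'h \<Rightarrow> ('h \<Rightarrow> 'h \<Rightarrow> 'k) \<Rightarrow> 'k" where
  "sw x b = pair2 (rep (Delta x)) b"

abbreviation (input) "\<Pi> \<equiv> PiL scale Delta eps"
abbreviation (input) "\<Pi>b \<equiv> PiLbar scale Delta eps"

lemma eps_simps [simp]: "eps (x + y) = eps x + eps y" "eps (scale c x) = c * eps x"
proof -
  interpret E: Vector_Spaces.linear scale "(*)" eps by (rule eps_linear)
  show "eps (x + y) = eps x + eps y" "eps (scale c x) = c * eps x"
    by (simp_all add: E.add E.scale)
qed

declare scale_mult_left [simp] scale_mult_right [simp]

lemma sw_add [simp]: "sw x (\<lambda>u v. b u v + c u v) = sw x b + sw x c"
  by (simp add: sw_def)

lemma sw_cmult [simp]: "c * sw x b = sw x (\<lambda>u v. c * b u v)"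
  by (simp add: sw_def pair2_cmult)

lemma sw_multc [simp]: "sw x b * c = sw x (\<lambda>u v. b u v * c)"
  by (simp add: sw_def pair2_multc)

lemma sw_swap:
  "sw x (\<lambda>p q. sw y (\<lambda>u v. b p q u v)) = sw y (\<lambda>u v. sw x (\<lambda>p q. b p q u v))"
  unfolding sw_def by (rule pair2_swap)

lemma lin1_sw:
  assumes "lin2 scale b"
  shows "lin1 scale (\<lambda>x. sw x b)"
  using assms by (simp add: lin1_def sw_def Delta_add Delta_scale qadd_def qscale_def)

lemma sw_simps:
  assumes "lin2 scale b"
  shows "sw (x + y) b = sw x b + sw y b" "sw (scale c x) b = sw x (\<lambda>u v. c * b u v)"
  using lin1D[OF lin1_sw[OF assms]] by simp_all

lemma sw_counit_left:
  assumes "lin1 scale \<phi>"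
  shows "sw x (\<lambda>u v. eps u * \<phi> v) = \<phi> x"
  using lin1_fext[OF assms vector_space_axioms, of "\<lambda>u v. scale (eps u) v" "rep (Delta x)"]
  by (simp add: counit_left sw_def lin1D[OF assms])

lemma sw_counit_right:
  assumes "lin1 scale \<phi>"
  shows "sw x (\<lambda>u v. eps v * \<phi> u) = \<phi> x"
  using lin1_fext[OF assms vector_space_axioms, of "\<lambda>u v. scale (eps v) u" "rep (Delta x)"]
  by (simp add: counit_right sw_def lin1D[OF assms])

lemma PiL_form:
  assumes "lin1 scale \<phi>"
  shows "\<phi> (\<Pi> x) = sw 1 (\<lambda>u v. eps (u * x) * \<phi> v)"
  using lin1_fext[OF assms vector_space_axioms, of "\<lambda>u v. scale (eps (u * x)) v" "rep (Delta 1)"]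
  by (simp add: PiL_def sw_def lin1D[OF assms])

lemma PiLbar_form:
  assumes "lin1 scale \<phi>"
  shows "\<phi> (\<Pi>b x) = sw 1 (\<lambda>u v. eps (v * x) * \<phi> u)"
  using lin1_fext[OF assms vector_space_axioms, of "\<lambda>u v. scale (eps (v * x)) u" "rep (Delta 1)"]
  by (simp add: PiLbar_def sw_def lin1D[OF assms])

lemma pair2_tmult2:
  assumes "lin2 scale b"
  shows "pair2 (rep (tmult2 scale t u)) b =
    pair2 (rep t) (\<lambda>x y. pair2 (rep u) (\<lambda>p q. b (x * p) (y * q)))"
  using assms by (simp add: tmult2_def pair2_fext)

lemma sw_mult:
  assumes "lin2 scale b"
  shows "sw (x * y) b = sw x (\<lambda>u v. sw y (\<lambda>p q. b (u * p) (v * q)))"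
  using assms by (simp add: sw_def Delta_mult pair2_tmult2)

text \<open>\<Delta>(1) acts as a two-sided unit on coproducts, by multiplicativity with one factor
  equal to 1, although it may differ from \<open>1 \<otimes> 1\<close>.\<close>

lemma sw_one_mult:
  assumes "lin2 scale b"
  shows "sw 1 (\<lambda>u v. sw x (\<lambda>p q. b (u * p) (v * q))) = sw x b"
    and "sw x (\<lambda>u v. sw 1 (\<lambda>p q. b (u * p) (v * q))) = sw x b"
  using sw_mult[OF assms, of 1 x] sw_mult[OF assms, of x 1] by simp_all

lemma eps_12: "sw y (\<lambda>u v. eps (x * u) * eps (v * z)) = eps (x * y * z)"
  by (simp add: eps_mult_12 sw_def pair2_def form_of_def)

lemma eps_21: "sw y (\<lambda>u v. eps (x * v) * eps (u * z)) = eps (x * y * z)"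
  by (simp add: eps_mult_21 sw_def pair2_def form_of_def)

lemma pair3_comult_id:
  assumes "lin3 scale t"
  shows "pair3 (rep (comult_id (null3 scale) Delta u)) t =
    pair2 (rep u) (\<lambda>x y. sw x (\<lambda>p q. t p q y))"
  using assms by (simp add: comult_id_def pair3_fext2 sw_def)

lemma pair3_id_comult:
  assumes "lin3 scale t"
  shows "pair3 (rep (id_comult (null3 scale) Delta u)) t =
    pair2 (rep u) (\<lambda>x y. sw y (\<lambda>p q. t x p q))"
  using assms by (simp add: id_comult_def pair3_fext2 sw_def)

lemma sw_coassoc:
  assumes "lin3 scale t"
  shows "sw x (\<lambda>u v. sw u (\<lambda>p q. t p q v)) = sw x (\<lambda>u v. sw v (\<lambda>p q. t u p q))"
  using pair3_comult_id[OF assms, of "Delta x"] pair3_id_comult[OF assms, of "Delta x"]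
  by (simp add: coassoc sw_def)

lemma lin3_mult_left:
  assumes "lin3 scale t"
  shows "lin3 scale (\<lambda>p q r. t (x * p) (y * q) (z * r))"
  using assms by (simp add: lin_defs distrib_left)

text \<open>The representative of the left factor of a threefold product can be eliminated only once
  the evaluation of the right factor is known to be trilinear in its parameters.\<close>

lemma lin3_pair3_mult:
  assumes "lin3 scale t"
  shows "lin3 scale (\<lambda>x y z. pair3 f (\<lambda>p q r. t (x * p) (y * q) (z * r)))"
proof -
  have "pair3 f b = (\<Sum>p\<in>Poly_Mapping.keys f.
      Poly_Mapping.lookup f p * b (fst p) (fst (snd p)) (snd (snd p)))" for b
    by (simp add: pair3_def form_of_def fext_def case_prod_unfold)
  then show ?thesis
    using lin3D[OF assms]
    by (simp add: lin_defs distrib_right distrib_left sum.distrib sum_distrib_left mult.left_commute)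
qed

lemma pair3_tmult3:
  assumes "lin3 scale t"
  shows "pair3 (rep (tmult3 scale (cls (null3 scale) f) (cls (null3 scale) g))) t =
    pair3 f (\<lambda>x y z. pair3 g (\<lambda>p q r. t (x * p) (y * q) (z * r)))"
proof -
  have "pair3 (rep (tmult3 scale (cls (null3 scale) f) (cls (null3 scale) g))) t =
    pair3 (rep (cls (null3 scale) f)) (\<lambda>x y z. pair3 (rep (cls (null3 scale) g))
      (\<lambda>p q r. t (x * p) (y * q) (z * r)))"
    using assms by (simp add: tmult3_def pair3_fext3)
  then show ?thesis
    by (simp add: lin3_mult_left[OF assms] lin3_pair3_mult[OF assms])
qed

lemma sw_one_12:
  assumes "lin3 scale t"
  shows "sw 1 (\<lambda>u v. sw u (\<lambda>p q. t p q v)) = sw 1 (\<lambda>u v. sw 1 (\<lambda>p q. t u (v * p) q))"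
  using pair3_comult_id[OF assms, of "Delta 1"] unfolding Delta_one_12 pair3_tmult3[OF assms]
  by (simp add: pair3_fext2 sw_def)

text \<open>Read as an iterated evaluation, the product
  \<open>(1 \<otimes> \<Delta>(1))(\<Delta>(1) \<otimes> 1)\<close> has the copy of \<Delta>(1) for
  the last two legs outside. Exchanging the copies gives the shape of \<open>sw_one_12\<close> with
  only the factors of the middle leg reversed.\<close>

lemma sw_one_21:
  assumes "lin3 scale t"
  shows "sw 1 (\<lambda>u v. sw u (\<lambda>p q. t p q v)) = sw 1 (\<lambda>u v. sw 1 (\<lambda>p q. t u (p * v) q))"
proof -
  have "sw 1 (\<lambda>u v. sw u (\<lambda>p q. t p q v)) = sw 1 (\<lambda>p q. sw 1 (\<lambda>u v. t u (p * v) q))"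
    using pair3_comult_id[OF assms, of "Delta 1"] unfolding Delta_one_21 pair3_tmult3[OF assms]
    by (simp add: pair3_fext2 sw_def)
  also have "\<dots> = sw 1 (\<lambda>u v. sw 1 (\<lambda>p q. t u (p * v) q))"
    by (rule sw_swap)
  finally show ?thesis .
qed

lemmas lin_simps = lin_defs distrib_left distrib_right mult.assoc mult.left_commute

section \<open>The projections \<open>\<Pi>\<close> and \<open>\<Pi>b\<close>\<close>

lemma PiL_simps [simp]:
  "\<Pi> (x + y) = \<Pi> x + \<Pi> y" "\<Pi> (scale c x) = scale c (\<Pi> x)"
proof -
  have "lin1 scale (\<lambda>x. \<phi> (\<Pi> x))" if \<phi>: "lin1 scale \<phi>" for \<phi>
    unfolding PiL_form[OF \<phi>] by (simp add: lin_simps)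
  from lin1D[OF this] show "\<Pi> (x + y) = \<Pi> x + \<Pi> y" "\<Pi> (scale c x) = scale c (\<Pi> x)"
    by (auto intro!: eq_if_lin1 simp: lin1D)
qed

lemma PiLbar_simps [simp]:
  "\<Pi>b (x + y) = \<Pi>b x + \<Pi>b y" "\<Pi>b (scale c x) = scale c (\<Pi>b x)"
proof -
  have "lin1 scale (\<lambda>x. \<phi> (\<Pi>b x))" if \<phi>: "lin1 scale \<phi>" for \<phi>
    unfolding PiLbar_form[OF \<phi>] by (simp add: lin_simps)
  from lin1D[OF this] show "\<Pi>b (x + y) = \<Pi>b x + \<Pi>b y" "\<Pi>b (scale c x) = scale c (\<Pi>b x)"
    by (auto intro!: eq_if_lin1 simp: lin1D)
qed

text \<open>Weak multiplicativity of the counit with middle factor 1, in the order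
  \<open>eps_21\<close>; the barred version below takes the order \<open>eps_12\<close>.\<close>

lemma eps_PiL [simp]: "eps (x * \<Pi> z) = eps (x * z)"
proof -
  have "eps (x * \<Pi> z) = sw 1 (\<lambda>u v. eps (u * z) * eps (x * v))"
    by (rule PiL_form) (simp add: lin_simps)
  then show ?thesis using eps_21[of 1 x z] by (simp add: mult.commute)
qed

lemma eps_PiLbar [simp]: "eps (x * \<Pi>b z) = eps (x * z)"
proof -
  have "eps (x * \<Pi>b z) = sw 1 (\<lambda>u v. eps (v * z) * eps (x * u))"
    by (rule PiLbar_form) (simp add: lin_simps)
  then show ?thesis using eps_12[of 1 x z] by (simp add: mult.commute)
qed

lemma PiL_mult_right [simp]: "\<Pi> (y * \<Pi> z) = \<Pi> (y * z)" "\<Pi> (y * \<Pi>b z) = \<Pi> (y * z)"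
  and PiLbar_mult_right [simp]: "\<Pi>b (y * \<Pi> z) = \<Pi>b (y * z)" "\<Pi>b (y * \<Pi>b z) = \<Pi>b (y * z)"
  by (simp_all add: PiL_def PiLbar_def flip: mult.assoc
      add: eps_PiL[unfolded PiL_def] eps_PiLbar[unfolded PiLbar_def])

lemma PiL_idem [simp]: "\<Pi> (\<Pi> z) = \<Pi> z" "\<Pi> (\<Pi>b z) = \<Pi> z"
  and PiLbar_idem [simp]: "\<Pi>b (\<Pi> z) = \<Pi>b z" "\<Pi>b (\<Pi>b z) = \<Pi>b z"
  using PiL_mult_right[of 1 z] PiLbar_mult_right[of 1 z] by simp_all

lemma PiL_one [simp]: "\<Pi> 1 = 1"
  by (rule eq_if_lin1) (simp add: PiL_form sw_counit_left)

lemma PiLbar_one [simp]: "\<Pi>b 1 = 1"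
  by (rule eq_if_lin1) (simp add: PiLbar_form sw_counit_right)

text \<open>Evaluate \<open>\<epsilon>\<close> on the middle leg of \<open>\<Delta>\<^sup>2(1)(\<Delta>(h) \<otimes> 1)\<close>, with \<open>\<Delta>\<^sup>2(1) = (1 \<otimes> \<Delta>(1))(\<Delta>(1) \<otimes> 1)\<close>.\<close>

lemma sw_one_left:
  assumes "lin2 scale b"
  shows "sw 1 (\<lambda>u v. b (u * h) v) = sw h (\<lambda>u v. b u (\<Pi> v))"
proof -
  note [simp] = lin2D[OF assms]
  have "b u (\<Pi> v) = sw 1 (\<lambda>p q. eps (p * v) * b u q)" for u v
    by (rule PiL_form) (simp add: lin_simps)
  then have "sw h (\<lambda>u v. b u (\<Pi> v)) = sw h (\<lambda>u v. sw 1 (\<lambda>p q. eps (p * v) * b u q))"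
    by simp
  also have "\<dots> = sw 1 (\<lambda>x y. sw h (\<lambda>u v. sw 1 (\<lambda>p q. eps (p * (y * v)) * b (x * u) q)))"
    by (rule sw_one_mult(1)[symmetric]) (simp add: lin_simps)
  also have "\<dots> = sw 1 (\<lambda>x y. sw 1 (\<lambda>p q. sw h (\<lambda>u v. eps (p * y * v) * b (x * u) q)))"
    by (simp only: sw_swap[where x = h and y = 1] mult.assoc)
  also have "\<dots> = sw 1 (\<lambda>x y. sw x (\<lambda>p q. sw h (\<lambda>u v. eps (q * v) * b (p * u) y)))"
    by (rule sw_one_21[symmetric]) (simp add: lin_simps)
  also have "\<dots> = sw 1 (\<lambda>x y. sw (x * h) (\<lambda>u v. eps v * b u y))"
    by (subst sw_mult) (simp_all add: lin_simps)
  also have "\<dots> = sw 1 (\<lambda>x y. b (x * h) y)"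
    by (subst sw_counit_right) (simp_all add: lin_simps)
  finally show ?thesis by simp
qed

section \<open>Coproducts of elements in the images of the projections\<close>

lemma sw_PiL:
  assumes "lin2 scale b"
  shows "sw (\<Pi> x) b = sw 1 (\<lambda>u v. b (u * \<Pi> x) v)"
    and "sw (\<Pi> x) b = sw 1 (\<lambda>u v. b (\<Pi> x * u) v)"
proof -
  note [simp] = lin2D[OF assms]
  \<comment> \<open>The plan is to apply \<open>eps (_ * x)\<close> to the first leg of the twofold
    coproduct of 1. Its two factorisations then place \<open>\<Pi> x\<close> to the right or to the
    left of the first remaining leg.\<close>
  have "sw (\<Pi> x) b = sw 1 (\<lambda>u v. eps (u * x) * sw v b)"
    by (rule PiL_form[OF lin1_sw[OF assms]])
  also have "\<dots> = sw 1 (\<lambda>u v. sw u (\<lambda>p q. eps (p * x) * b q v))"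
    by (subst sw_coassoc) (simp_all add: lin_simps)
  finally have *: "sw (\<Pi> x) b = sw 1 (\<lambda>u v. sw u (\<lambda>p q. eps (p * x) * b q v))" .
  also have "\<dots> = sw 1 (\<lambda>u v. sw 1 (\<lambda>p q. eps (u * x) * b (p * v) q))"
    by (rule sw_one_21) (simp add: lin_simps)
  also have "\<dots> = sw 1 (\<lambda>p q. sw 1 (\<lambda>u v. eps (u * x) * b (p * v) q))"
    by (rule sw_swap)
  also have "\<dots> = sw 1 (\<lambda>u v. b (u * \<Pi> x) v)"
    by (subst PiL_form[symmetric]) (simp_all add: lin_simps)
  finally show "sw (\<Pi> x) b = sw 1 (\<lambda>u v. b (u * \<Pi> x) v)" .
  note *
  also have "sw 1 (\<lambda>u v. sw u (\<lambda>p q. eps (p * x) * b q v)) =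
      sw 1 (\<lambda>u v. sw 1 (\<lambda>p q. eps (u * x) * b (v * p) q))"
    by (rule sw_one_12) (simp add: lin_simps)
  also have "\<dots> = sw 1 (\<lambda>p q. sw 1 (\<lambda>u v. eps (u * x) * b (v * p) q))"
    by (rule sw_swap)
  also have "\<dots> = sw 1 (\<lambda>u v. b (\<Pi> x * u) v)"
    by (subst PiL_form[symmetric]) (simp_all add: lin_simps)
  finally show "sw (\<Pi> x) b = sw 1 (\<lambda>u v. b (\<Pi> x * u) v)" .
qed

text \<open>Mirror image of \<open>sw_PiL\<close>: the counit is applied to the third leg, and
  \<open>\<Pi>b x\<close> ends up in the second.\<close>

lemma sw_PiLbar:
  assumes "lin2 scale b"
  shows "sw (\<Pi>b x) b = sw 1 (\<lambda>u v. b u (v * \<Pi>b x))"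
    and "sw (\<Pi>b x) b = sw 1 (\<lambda>u v. b u (\<Pi>b x * v))"
proof -
  note [simp] = lin2D[OF assms]
  have *: "sw (\<Pi>b x) b = sw 1 (\<lambda>u v. sw u (\<lambda>p q. eps (v * x) * b p q))"
    using PiLbar_form[OF lin1_sw[OF assms], of x] by simp
  also have "\<dots> = sw 1 (\<lambda>u v. sw 1 (\<lambda>p q. eps (q * x) * b u (v * p)))"
    by (rule sw_one_12) (simp add: lin_simps)
  also have "\<dots> = sw 1 (\<lambda>u v. b u (v * \<Pi>b x))"
    by (subst PiLbar_form[symmetric]) (simp_all add: lin_simps)
  finally show "sw (\<Pi>b x) b = sw 1 (\<lambda>u v. b u (v * \<Pi>b x))" .
  note *
  also have "sw 1 (\<lambda>u v. sw u (\<lambda>p q. eps (v * x) * b p q)) =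
      sw 1 (\<lambda>u v. sw 1 (\<lambda>p q. eps (q * x) * b u (p * v)))"
    by (rule sw_one_21) (simp add: lin_simps)
  also have "\<dots> = sw 1 (\<lambda>u v. b u (\<Pi>b x * v))"
    by (subst PiLbar_form[symmetric]) (simp_all add: lin_simps)
  finally show "sw (\<Pi>b x) b = sw 1 (\<lambda>u v. b u (\<Pi>b x * v))" .
qed

text \<open>Left linearity of \<Delta> over the base holds already over the field:
  \<Delta>(\<open>\<Pi> x\<close>) is \<Delta>(1) with \<open>\<Pi> x\<close> on the left of its
  first leg, and \<Delta>(h) absorbs \<Delta>(1).\<close>

lemma sw_PiL_mult:
  assumes "lin2 scale b"
  shows "sw (\<Pi> x * h) b = sw h (\<lambda>u v. b (\<Pi> x * u) v)"
proof -
  note [simp] = lin2D[OF assms]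
  have "sw (\<Pi> x * h) b = sw (\<Pi> x) (\<lambda>u v. sw h (\<lambda>p q. b (u * p) (v * q)))"
    by (rule sw_mult[OF assms])
  also have "\<dots> = sw 1 (\<lambda>u v. sw h (\<lambda>p q. b (\<Pi> x * u * p) (v * q)))"
    by (rule sw_PiL(2)) (simp add: lin_simps)
  also have "\<dots> = sw h (\<lambda>u v. b (\<Pi> x * u) v)"
    unfolding mult.assoc by (rule sw_one_mult(1)) (simp add: lin_simps)
  finally show ?thesis .
qed

text \<open>The corresponding right linearity, since the right action of the base is left
  multiplication by the target map.\<close>

lemma sw_PiLbar_mult:
  assumes "lin2 scale b"
  shows "sw (\<Pi>b x * h) b = sw h (\<lambda>u v. b u (\<Pi>b x * v))"
proof -
  note [simp] = lin2D[OF assms]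
  have "sw (\<Pi>b x * h) b = sw (\<Pi>b x) (\<lambda>u v. sw h (\<lambda>p q. b (u * p) (v * q)))"
    by (rule sw_mult[OF assms])
  also have "\<dots> = sw 1 (\<lambda>u v. sw h (\<lambda>p q. b (u * p) (\<Pi>b x * v * q)))"
    by (rule sw_PiLbar(2)) (simp add: lin_simps)
  also have "\<dots> = sw h (\<lambda>u v. b u (\<Pi>b x * v))"
    unfolding mult.assoc by (rule sw_one_mult(1)) (simp add: lin_simps)
  finally show ?thesis .
qed

section \<open>Products of projected elements\<close>

lemma PiL_PiL_mult [simp]: "\<Pi> (\<Pi> x * y) = \<Pi> x * \<Pi> y"
proof (rule eq_if_lin1)
  fix \<phi> assume \<phi>: "lin1 scale \<phi>"
  note [simp] = lin1D[OF \<phi>]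
  \<comment> \<open>The counit is inserted so that both factors can be moved onto the first leg,
    where they sit inside \<open>eps\<close> as in the defining formula of
    \<open>\<Pi>\<close>.\<close>
  have "\<phi> (\<Pi> x * \<Pi> y) = sw (\<Pi> x * \<Pi> y) (\<lambda>u v. eps u * \<phi> v)"
    by (rule sw_counit_left[OF \<phi>, symmetric])
  also have "\<dots> = sw (\<Pi> y) (\<lambda>u v. eps (\<Pi> x * u) * \<phi> v)"
    by (rule sw_PiL_mult) (simp add: lin_simps)
  also have "\<dots> = sw 1 (\<lambda>u v. eps (\<Pi> x * (u * \<Pi> y)) * \<phi> v)"
    by (rule sw_PiL(1)) (simp add: lin_simps)
  \<comment> \<open>Passing through \<Delta>(\<open>\<Pi> x\<close>) and its two expressions in
    \<open>sw_PiL\<close> carries \<open>\<Pi> x\<close> from the left of \<open>u\<close> to the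
    right.\<close>
  also have "\<dots> = sw (\<Pi> x) (\<lambda>u v. eps (u * \<Pi> y) * \<phi> v)"
    unfolding mult.assoc[symmetric]
    by (rule sw_PiL(2)[symmetric]) (simp add: lin_simps)
  also have "\<dots> = sw 1 (\<lambda>u v. eps (u * \<Pi> x * \<Pi> y) * \<phi> v)"
    by (rule sw_PiL(1)) (simp add: lin_simps)
  also have "\<dots> = \<phi> (\<Pi> (\<Pi> x * y))"
    using PiL_form[OF \<phi>, of "\<Pi> x * \<Pi> y"] by (simp add: mult.assoc)
  finally show "\<phi> (\<Pi> (\<Pi> x * y)) = \<phi> (\<Pi> x * \<Pi> y)" by simp
qed

lemma PiLbar_PiLbar_mult [simp]: "\<Pi>b (\<Pi>b x * y) = \<Pi>b x * \<Pi>b y"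
proof (rule eq_if_lin1)
  fix \<phi> assume \<phi>: "lin1 scale \<phi>"
  note [simp] = lin1D[OF \<phi>]
  have "\<phi> (\<Pi>b x * \<Pi>b y) = sw (\<Pi>b x * \<Pi>b y) (\<lambda>u v. eps v * \<phi> u)"
    by (rule sw_counit_right[OF \<phi>, symmetric])
  also have "\<dots> = sw (\<Pi>b y) (\<lambda>u v. eps (\<Pi>b x * v) * \<phi> u)"
    by (rule sw_PiLbar_mult) (simp add: lin_simps)
  also have "\<dots> = sw 1 (\<lambda>u v. eps (\<Pi>b x * (v * \<Pi>b y)) * \<phi> u)"
    by (rule sw_PiLbar(1)) (simp add: lin_simps)
  also have "\<dots> = sw (\<Pi>b x) (\<lambda>u v. eps (v * \<Pi>b y) * \<phi> u)"
    unfolding mult.assoc[symmetric]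
    by (rule sw_PiLbar(2)[symmetric]) (simp add: lin_simps)
  also have "\<dots> = sw 1 (\<lambda>u v. eps (v * \<Pi>b x * \<Pi>b y) * \<phi> u)"
    by (rule sw_PiLbar(1)) (simp add: lin_simps)
  also have "\<dots> = \<phi> (\<Pi>b (\<Pi>b x * y))"
    using PiLbar_form[OF \<phi>, of "\<Pi>b x * \<Pi>b y"] by (simp add: mult.assoc)
  finally show "\<phi> (\<Pi>b (\<Pi>b x * y)) = \<phi> (\<Pi>b x * \<Pi>b y)" by simp
qed

text \<open>Evaluate \<open>eps (_ * x)\<close> on the first and \<open>eps (_ * y)\<close> on the
  third leg of the twofold coproduct of 1. The middle leg becomes one product or the other,
  depending on the factorisation used.\<close>

lemma PiL_PiLbar_commute: "\<Pi> x * \<Pi>b y = \<Pi>b y * \<Pi> x"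
proof (rule eq_if_lin1)
  fix \<phi> assume \<phi>: "lin1 scale \<phi>"
  note [simp] = lin1D[OF \<phi>]
  have A: "\<phi> (\<Pi> x * z) = sw 1 (\<lambda>u v. eps (u * x) * \<phi> (v * z))"
    and B: "\<phi> (z * \<Pi> x) = sw 1 (\<lambda>u v. eps (u * x) * \<phi> (z * v))"
    and C: "\<phi> (z * \<Pi>b y) = sw 1 (\<lambda>u v. eps (v * y) * \<phi> (z * u))"
    and D: "\<phi> (\<Pi>b y * z) = sw 1 (\<lambda>u v. eps (v * y) * \<phi> (u * z))" for z
    by (rule PiL_form PiLbar_form, simp add: lin_simps)+
  have t: "lin3 scale (\<lambda>p q r. eps (p * x) * (eps (r * y) * \<phi> q))"
    by (simp add: lin_simps)
  show "\<phi> (\<Pi> x * \<Pi>b y) = \<phi> (\<Pi>b y * \<Pi> x)"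
    unfolding A[of "\<Pi>b y"] B[of "\<Pi>b y"] unfolding C D
    using sw_one_12[OF t] sw_one_21[OF t] by simp
qed

text \<open>Replace \<open>h\<close> by \<open>\<Pi> h\<close>, commute it past
  \<open>\<Pi>b a\<close>, and use multiplicativity. This is the right linearity of the
  counit.\<close>

lemma PiL_PiLbar_mult: "\<Pi> (\<Pi>b a * h) = \<Pi> h * \<Pi> a"
  using PiL_mult_right(1)[of "\<Pi>b a" h] PiL_PiL_mult[of h "\<Pi>b a"]
  by (simp add: PiL_PiLbar_commute del: PiL_PiL_mult)

text \<open>Inside \<open>\<Pi>b\<close> the factor \<open>\<Pi> y\<close> may be traded for
  \<open>\<Pi>b y\<close>, which commutes with \<open>\<Pi> x\<close>; this reverses the order and
  makes the target map an antihomomorphism.\<close>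

lemma PiLbar_antimult: "\<Pi>b (\<Pi> x * \<Pi> y) = \<Pi>b (\<Pi> y) * \<Pi>b (\<Pi> x)"
proof -
  have "\<Pi>b (\<Pi> x * \<Pi> y) = \<Pi>b (\<Pi> x * \<Pi>b y)" by simp
  also have "\<dots> = \<Pi>b (\<Pi>b y * \<Pi> x)" by (simp only: PiL_PiLbar_commute)
  also have "\<dots> = \<Pi>b (\<Pi> y) * \<Pi>b (\<Pi> x)" by (simp del: PiLbar_mult_right)
  finally show ?thesis .
qed

text \<open>\<open>sw_one_left\<close> turns right multiplication of the first leg into an
  application of \<open>\<Pi>\<close> to the second leg of \<Delta>(\<open>\<Pi>b x\<close>), and
  that coproduct is known from \<open>sw_PiLbar\<close>.\<close>

lemma sw_one_balanced:
  assumes "lin2 scale b"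
  shows "sw 1 (\<lambda>u v. b (u * \<Pi>b x) v) = sw 1 (\<lambda>u v. b u (v * \<Pi> x))"
proof -
  note [simp] = lin2D[OF assms]
  have "sw 1 (\<lambda>u v. b (u * \<Pi>b x) v) = sw (\<Pi>b x) (\<lambda>u v. b u (\<Pi> v))"
    by (rule sw_one_left[OF assms])
  also have "\<dots> = sw 1 (\<lambda>u v. b u (\<Pi> (v * \<Pi>b x)))"
    by (rule sw_PiLbar(1)) (simp add: lin_simps)
  also have "\<dots> = sw 1 (\<lambda>u v. b u (\<Pi> (v * x)))" by simp
  \<comment> \<open>At \<open>h = 1\<close>, \<open>sw_one_left\<close> says that
    \<open>\<Pi>\<close> may be applied to the second leg of \<Delta>(1) without changing it. It is
    used here to insert \<open>\<Pi>\<close> and at the end to remove it.\<close>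
  also have "\<dots> = sw 1 (\<lambda>u v. b u (\<Pi> (\<Pi> v * x)))"
    using sw_one_left[of "\<lambda>u v. b u (\<Pi> (v * x))" 1] by (simp add: lin_simps)
  also have "\<dots> = sw 1 (\<lambda>u v. b u (\<Pi> v * \<Pi> x))" by simp
  also have "\<dots> = sw 1 (\<lambda>u v. b u (v * \<Pi> x))"
    using sw_one_left[of "\<lambda>u v. b u (v * \<Pi> x)" 1] by (simp add: lin_simps)
  finally show ?thesis .
qed

section \<open>The bialgebroid\<close>

lemma base_algebra_range_PiL: "base_algebra scale (range \<Pi>)"
proof
  show "subspace (range \<Pi>)"
    unfolding subspace_def by (auto simp flip: PiL_simps) (metis PiL_simps(2) rangeI scale_zero_left)
  show "1 \<in> range \<Pi>" by (metis PiL_one rangeI)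
  show "a * b \<in> range \<Pi>" if "a \<in> range \<Pi>" "b \<in> range \<Pi>" for a b
    using that by (auto simp flip: PiL_PiL_mult)
qed

lemma source_target_ring_PiL: "source_target_ring scale (range \<Pi>) scale (\<lambda>a. a) \<Pi>b"
  by (intro source_target_ring.intro base_algebra_range_PiL unital_algebra_axioms
      source_target_ring_axioms.intro)
    (auto simp: PiLbar_antimult PiL_PiLbar_commute simp del: PiLbar_mult_right)

section \<open>The coring over the base algebra\<close>

abbreviation balanced :: "('h \<Rightarrow> 'h \<Rightarrow> 'k) \<Rightarrow> bool" where
  "balanced \<equiv> bal2 scale (range \<Pi>) (\<lambda>a h. a * h) (\<lambda>h a. \<Pi>b a * h)"

abbreviation N2 :: "('h \<times> 'h \<Rightarrow>\<^sub>0 'k) set" where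
  "N2 \<equiv> bnull2 scale (range \<Pi>) (\<lambda>a h. a * h) (\<lambda>h a. \<Pi>b a * h)"

abbreviation N3 :: "('h \<times> 'h \<times> 'h \<Rightarrow>\<^sub>0 'k) set" where
  "N3 \<equiv> bnull3 scale (range \<Pi>) (\<lambda>a h. a * h) (\<lambda>h a. \<Pi>b a * h)"

abbreviation Dbal :: "'h \<Rightarrow> ('h \<times> 'h \<Rightarrow>\<^sub>0 'k) set" where
  "Dbal h \<equiv> cls N2 (rep (Delta h))"

text \<open>The parameter \<open>z\<close> may range over the whole algebra because
  \<open>\<Pi>b (\<Pi> z) = \<Pi>b z\<close>.\<close>

lemma balanced_iff:
  "balanced b \<longleftrightarrow> lin2 scale b \<and> (\<forall>z x y. b (\<Pi>b z * x) y = b x (\<Pi> z * y))"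
  by (auto simp: bal2_def)

lemma balancedD:
  assumes "balanced b"
  shows "lin2 scale b" "b (\<Pi>b z * x) y = b x (\<Pi> z * y)"
  using assms by (auto simp: balanced_iff)

text \<open>Balanced forms do not distinguish \<Delta>(h) from its image over the base, so the
  Sweedler identities over the field carry over.\<close>

lemma pair2_Dbal: "balanced b \<Longrightarrow> pair2 (rep (Dbal h)) b = sw h b"
  by (simp add: sw_def)

text \<open>For balanced \<open>t\<close> both sides reduce to coassociativity over the field, once
  the inner evaluations are shown to be balanced forms of the outer legs.\<close>

lemma Dbal_coassoc: "comult_id N3 Dbal (Dbal h) = id_comult N3 Dbal (Dbal h)"
  unfolding comult_id_def id_comult_def cls_bnull3_eq_iff pair3_fext2
proof (intro allI impI)
  fix t assume "bal3 scale (range \<Pi>) (\<lambda>a h. a * h) (\<lambda>h a. \<Pi>b a * h) t"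
  then have t: "lin3 scale t"
    and t1: "t (\<Pi>b z * x) y w = t x (\<Pi> z * y) w"
    and t2: "t x (\<Pi>b z * y) w = t x y (\<Pi> z * w)" for z x y w
    by (auto simp: bal3_def)
  note [simp] = lin3D[OF t] t1 t2
  have b1: "balanced (\<lambda>u v. t u v y)" for y
    unfolding balanced_iff by (simp add: lin_simps)
  have b2: "balanced (\<lambda>u v. t y u v)" for y
    unfolding balanced_iff by (simp add: lin_simps)
  note [simp] = balancedD(1)[OF b1] balancedD(1)[OF b2]
  \<comment> \<open>Simplification eta-contracts \<open>\<lambda>u v. t x u v\<close> to
    \<open>t x\<close>, so the rules for \<open>t\<close> are also needed as equations between
    functions.\<close>
  have [simp]: "t (x + y) = (\<lambda>u v. t x u v + t y u v)" "t (scale c x) = (\<lambda>u v. c * t x u v)"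
    "t (\<Pi>b z * x) = (\<lambda>u. t x (\<Pi> z * u))" for x y z c
    by (simp_all add: fun_eq_iff)
  \<comment> \<open>This is the well-definedness of \<open>Dbal \<otimes> id\<close> over the base:
    linearity of \<Delta> moves \<open>\<Pi>b z\<close> to the middle leg, and balancing of
    \<open>t\<close> moves it on to the third.\<close>
  have b3: "balanced (\<lambda>x y. sw x (\<lambda>u v. t u v y))"
    unfolding balanced_iff by (simp add: sw_PiLbar_mult lin1_sw) (simp add: lin_simps sw_simps)
  have b4: "balanced (\<lambda>x y. sw y (\<lambda>u v. t x u v))"
    unfolding balanced_iff by (simp add: sw_PiL_mult lin1_sw) (simp add: lin_simps sw_simps)
  show "pair2 (rep (Dbal h)) (\<lambda>x y. pair2 (rep (Dbal x)) (\<lambda>u v. pair3 (gen (u, v, y)) t)) =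
      pair2 (rep (Dbal h)) (\<lambda>x y. pair2 (rep (Dbal y)) (\<lambda>u v. pair3 (gen (x, u, v)) t))"
    unfolding pair3_gen pair2_Dbal[OF b1] pair2_Dbal[OF b2]
      pair2_Dbal[OF b3] pair2_Dbal[OF b4] by (rule sw_coassoc[OF t])
qed

text \<open>Expanding \<open>\<Pi> x\<close> by its definition produces the product
  \<Delta>(1)\<Delta>(h) with \<open>eps\<close> on the first leg, so the counit axiom applies. The
  other side is the mirror image.\<close>

lemma counit_PiL_left: "fext scale (\<lambda>(x, y). \<Pi> x * y) (rep (Dbal h)) = h"
proof (rule eq_if_lin1)
  fix \<phi> assume \<phi>: "lin1 scale \<phi>"
  note [simp] = lin1D[OF \<phi>]
  have b: "balanced (\<lambda>x y. \<phi> (\<Pi> x * y))"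
    unfolding balanced_iff by (simp add: PiL_PiLbar_mult lin_simps)
  have A: "\<phi> (\<Pi> x * y) = sw 1 (\<lambda>u v. eps (u * x) * \<phi> (v * y))" for x y
    by (rule PiL_form) (simp add: lin_simps)
  have "\<phi> (fext scale (\<lambda>(x, y). \<Pi> x * y) (rep (Dbal h))) = sw h (\<lambda>x y. \<phi> (\<Pi> x * y))"
    by (simp add: lin1_fext[OF \<phi> vector_space_axioms] b sw_def)
  also have "\<dots> = sw 1 (\<lambda>u v. sw h (\<lambda>x y. eps (u * x) * \<phi> (v * y)))"
    unfolding A by (rule sw_swap)
  also have "\<dots> = sw h (\<lambda>x y. eps x * \<phi> y)"
    by (rule sw_one_mult(1)) (simp add: lin_simps)
  also have "\<dots> = \<phi> h" by (rule sw_counit_left[OF \<phi>])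
  finally show "\<phi> (fext scale (\<lambda>(x, y). \<Pi> x * y) (rep (Dbal h))) = \<phi> h" .
qed

lemma counit_PiL_right: "fext scale (\<lambda>(x, y). \<Pi>b y * x) (rep (Dbal h)) = h"
proof (rule eq_if_lin1)
  fix \<phi> assume \<phi>: "lin1 scale \<phi>"
  note [simp] = lin1D[OF \<phi>]
  have b: "balanced (\<lambda>x y. \<phi> (\<Pi>b y * x))"
  proof -
    have "\<Pi>b (\<Pi> z * y) = \<Pi>b y * \<Pi>b z" for z y
      using PiLbar_antimult[of z y] by simp
    then show ?thesis unfolding balanced_iff by (simp add: lin_simps)
  qed
  have A: "\<phi> (\<Pi>b y * x) = sw 1 (\<lambda>u v. eps (v * y) * \<phi> (u * x))" for x y
    by (rule PiLbar_form) (simp add: lin_simps)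
  have "\<phi> (fext scale (\<lambda>(x, y). \<Pi>b y * x) (rep (Dbal h))) = sw h (\<lambda>x y. \<phi> (\<Pi>b y * x))"
    by (simp add: lin1_fext[OF \<phi> vector_space_axioms] b sw_def)
  also have "\<dots> = sw 1 (\<lambda>u v. sw h (\<lambda>x y. eps (v * y) * \<phi> (u * x)))"
    unfolding A by (rule sw_swap)
  also have "\<dots> = sw h (\<lambda>x y. eps y * \<phi> x)"
    by (rule sw_one_mult(1)) (simp add: lin_simps)
  also have "\<dots> = \<phi> h" by (rule sw_counit_right[OF \<phi>])
  finally show "\<phi> (fext scale (\<lambda>(x, y). \<Pi>b y * x) (rep (Dbal h))) = \<phi> h" .
qed

text \<open>Since source and target images commute, multiplying the first leg by
  \<open>\<Pi> a\<close> preserves balanced forms; linearity of \<Delta> over the field then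
  descends.\<close>

lemma Dbal_PiL_mult:
  "Dbal (\<Pi> a * h) = cls N2 (fext fscale (\<lambda>(x, y). gen (\<Pi> a * x, y)) (rep (Dbal h)))"
  unfolding cls_bnull2_eq_iff pair2_fext
proof (intro allI impI)
  fix b assume b: "balanced b"
  note [simp] = lin2D[OF balancedD(1)[OF b]] balancedD(2)[OF b]
  have "b (\<Pi> a * (\<Pi>b z * x)) y = b (\<Pi> a * x) (\<Pi> z * y)" for z x y
    by (metis PiL_PiLbar_commute mult.assoc balancedD(2)[OF b])
  then have "balanced (\<lambda>x y. b (\<Pi> a * x) y)"
    unfolding balanced_iff by (simp add: lin_simps)
  then show "pair2 (rep (Delta (\<Pi> a * h))) b =
      pair2 (rep (Dbal h)) (\<lambda>x y. pair2 (gen (\<Pi> a * x, y)) b)"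
    using sw_PiL_mult[OF balancedD(1)[OF b]] by (simp add: sw_def)
qed

lemma Dbal_PiLbar_mult:
  "Dbal (\<Pi>b a * h) = cls N2 (fext fscale (\<lambda>(x, y). gen (x, \<Pi>b a * y)) (rep (Dbal h)))"
  unfolding cls_bnull2_eq_iff pair2_fext
proof (intro allI impI)
  fix b assume b: "balanced b"
  note [simp] = lin2D[OF balancedD(1)[OF b]] balancedD(2)[OF b]
  have "b (\<Pi>b z * x) (\<Pi>b a * y) = b x (\<Pi>b a * (\<Pi> z * y))" for z x y
    by (metis PiL_PiLbar_commute mult.assoc balancedD(2)[OF b])
  then have "balanced (\<lambda>x y. b x (\<Pi>b a * y))"
    unfolding balanced_iff by (simp add: lin_simps)
  then show "pair2 (rep (Delta (\<Pi>b a * h))) b =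
      pair2 (rep (Dbal h)) (\<lambda>x y. pair2 (gen (x, \<Pi>b a * y)) b)"
    using sw_PiLbar_mult[OF balancedD(1)[OF b]] by (simp add: sw_def)
qed

lemma coring_PiL:
  "coring scale (range \<Pi>) scale (\<lambda>a h. a * h) (\<lambda>h a. \<Pi>b a * h) Dbal \<Pi>"
proof (intro coring.intro base_algebra_range_PiL vector_space_axioms coring_axioms.intro)
  fix a b h assume "a \<in> range \<Pi>" "b \<in> range \<Pi>"
  then obtain x y where ab: "a = \<Pi> x" "b = \<Pi> y" by auto
  show "\<Pi>b b * (a * h) = a * (\<Pi>b b * h)"
    unfolding ab using PiL_PiLbar_commute[of x "\<Pi> y"] by (simp flip: mult.assoc)
  show "\<Pi>b (a * b) * h = \<Pi>b b * (\<Pi>b a * h)"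
    unfolding ab by (simp only: PiLbar_antimult mult.assoc)
next
  fix a h assume "a \<in> range \<Pi>"
  then obtain z where a: "a = \<Pi> z" by auto
  show "Dbal (a * h) = cls N2 (fext fscale (\<lambda>(x, y). gen (a * x, y)) (rep (Dbal h)))"
    unfolding a by (rule Dbal_PiL_mult)
  show "Dbal (\<Pi>b a * h) = cls N2 (fext fscale (\<lambda>(x, y). gen (x, \<Pi>b a * y)) (rep (Dbal h)))"
    by (rule Dbal_PiLbar_mult)
  show "\<Pi> (a * h) = a * \<Pi> h" "\<Pi> (\<Pi>b a * h) = \<Pi> h * a"
    unfolding a by (simp_all add: PiL_PiLbar_mult)
next
  fix g h c
  show "Dbal (g + h) = qadd N2 (Dbal g) (Dbal h)"
    unfolding qadd_def cls_bnull2_eq_iff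
    by (simp add: pair2_Dbal sw_simps(1) balancedD(1) flip: sw_def)
  show "Dbal (scale c h) = qscale N2 c (Dbal h)"
    unfolding qscale_def cls_bnull2_eq_iff
    by (simp add: pair2_Dbal sw_simps(2) balancedD(1) flip: sw_def)
  show "comult_id N3 Dbal (Dbal h) = id_comult N3 Dbal (Dbal h)"
    by (rule Dbal_coassoc)
  show "fext scale (\<lambda>(x, y). \<Pi> x * y) (rep (Dbal h)) = h"
    by (rule counit_PiL_left)
  show "fext scale (\<lambda>(x, y). \<Pi>b (\<Pi> y) * x) (rep (Dbal h)) = h"
    unfolding PiLbar_idem by (rule counit_PiL_right)
  show "Vector_Spaces.linear scale scale \<Pi>" "Vector_Spaces.linear scale scale ((*) a)"
    "Vector_Spaces.linear scale scale (\<lambda>h. \<Pi>b a * h)" for a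
    by (simp_all add: Vector_Spaces.linear_iff vector_space_axioms distrib_left)
qed (simp_all add: distrib_right mult.assoc)

text \<open>Compatibility with products is the absorption rule
  \<open>\<Pi> (g * \<Pi> (h * a)) = \<Pi> (g * (h * a))\<close>.\<close>

lemma left_action_PiL: "left_action scale scale (range \<Pi>) (\<lambda>h a. \<Pi> (h * a))"
  by (auto simp: left_action_def distrib_left distrib_right mult.assoc)

text \<open>The second leg of \<Delta>(1) may be replaced by its image under \<open>\<Pi>\<close>,
  which balancing moves to the first leg as a target element. What remains is the right counit
  identity at 1.\<close>

lemma Dbal_one: "Dbal 1 = cls N2 (gen (1, 1))"
  unfolding cls_bnull2_eq_iff
proof (intro allI impI)
  fix b assume b: "balanced b"
  note bD = balancedD[OF b]
  note [simp] = lin2D[OF bD(1)]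
  have e: "b (\<Pi>b v * u) 1 = sw 1 (\<lambda>p q. eps (q * v) * b (p * u) 1)" for u v
    by (rule PiLbar_form) (simp add: lin_simps)
  have "sw 1 b = sw 1 (\<lambda>u v. b u (\<Pi> v * 1))"
    using sw_one_left[OF bD(1), of 1] by simp
  also have "\<dots> = sw 1 (\<lambda>u v. sw 1 (\<lambda>p q. eps (q * v) * b (p * u) 1))"
    by (simp only: e flip: bD(2))
  also have "\<dots> = sw 1 (\<lambda>p q. sw 1 (\<lambda>u v. eps (q * v) * b (p * u) 1))"
    by (rule sw_swap)
  also have "\<dots> = sw 1 (\<lambda>u v. eps v * b u 1)"
    by (rule sw_one_mult(1)) (simp add: lin_simps)
  also have "\<dots> = b 1 1"
    by (rule sw_counit_right) (simp add: lin_simps)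
  finally show "pair2 (rep (Delta 1)) b = pair2 (gen (1, 1)) b"
    by (simp add: sw_def)
qed

section \<open>The corner algebra cut out by \<Delta>(1)\<close>

lemma lin2_tmult2:
  assumes "lin2 scale b"
  shows "lin2 scale (\<lambda>x y. pair2 f (\<lambda>p q. b (x * p) (y * q)))"
    and "lin2 scale (\<lambda>p q. b (x * p) (y * q))"
    and "lin2 scale (\<lambda>p q. pair2 f (\<lambda>x y. b (x * p) (y * q)))"
  using lin2D[OF assms] by (simp_all add: lin_simps pair2_cmult)

lemma tmult2_in_quot [simp]: "tmult2 scale t u \<in> quot (null2 scale)"
  by (simp add: tmult2_def)

lemma tmult2_assoc: "tmult2 scale (tmult2 scale t u) w = tmult2 scale t (tmult2 scale u w)"
proof (rule quot_null2_eqI[where s = scale])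
  fix b assume b: "lin2 scale b"
  show "pair2 (rep (tmult2 scale (tmult2 scale t u) w)) b =
      pair2 (rep (tmult2 scale t (tmult2 scale u w))) b"
    unfolding pair2_tmult2[OF b] pair2_tmult2[OF lin2_tmult2(1)[OF b]]
      pair2_tmult2[OF lin2_tmult2(2)[OF b]] mult.assoc ..
qed simp_all

text \<open>\<Delta>(1) is idempotent, so its corner consists of the tensors fixed by multiplication
  with it on either side.\<close>

lemma corner_iff:
  "t \<in> corner scale Delta \<longleftrightarrow> t \<in> quot (null2 scale) \<and>
    tmult2 scale (Delta 1) t = t \<and> tmult2 scale t (Delta 1) = t"
proof
  have idem: "tmult2 scale (Delta 1) (Delta 1) = Delta 1"
    using Delta_mult[of 1 1] by simp
  assume "t \<in> corner scale Delta"
  then obtain u where u: "t = tmult2 scale (tmult2 scale (Delta 1) u) (Delta 1)"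
    by (auto simp: corner_def)
  have "tmult2 scale (Delta 1) t = t"
    unfolding u by (simp only: idem flip: tmult2_assoc)
  moreover have "tmult2 scale t (Delta 1) = t"
    unfolding u by (simp only: idem tmult2_assoc)
  ultimately show "t \<in> quot (null2 scale) \<and>
      tmult2 scale (Delta 1) t = t \<and> tmult2 scale t (Delta 1) = t"
    by (simp add: u)
next
  assume "t \<in> quot (null2 scale) \<and> tmult2 scale (Delta 1) t = t \<and> tmult2 scale t (Delta 1) = t"
  then show "t \<in> corner scale Delta"
    unfolding corner_def by (intro CollectI exI[of _ t]) simp
qed

lemma Delta_in_corner: "Delta x \<in> corner scale Delta"
  using Delta_mult[of 1 x] Delta_mult[of x 1] by (simp add: corner_iff Delta_in)

lemma tmult2_linear:
  "tmult2 scale t (qadd (null2 scale) u w) =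
    qadd (null2 scale) (tmult2 scale t u) (tmult2 scale t w)"
  "tmult2 scale (qadd (null2 scale) u w) t =
    qadd (null2 scale) (tmult2 scale u t) (tmult2 scale w t)"
  "tmult2 scale t (qscale (null2 scale) c u) = qscale (null2 scale) c (tmult2 scale t u)"
  "tmult2 scale (qscale (null2 scale) c u) t = qscale (null2 scale) c (tmult2 scale u t)"
  "tmult2 scale t (cls (null2 scale) 0) = cls (null2 scale) 0"
  "tmult2 scale (cls (null2 scale) 0) t = cls (null2 scale) 0"
proof -
  have eqI: "t' = cls (null2 scale) f"
    if "t' \<in> quot (null2 scale)" "\<And>b. lin2 scale b \<Longrightarrow> pair2 (rep t') b = pair2 f b" for t' f
    by (rule quot_null2_eqI[where s = scale]) (simp_all add: that)
  \<comment> \<open>With an explicit class as a factor, the product can be evaluated at the given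
    representative. These equations come before the general \<open>pair2_tmult2\<close>, which would
    leave \<open>rep\<close> of that class in place.\<close>
  have left: "pair2 (rep (tmult2 scale (cls (null2 scale) f) t)) b =
      pair2 f (\<lambda>x y. pair2 (rep t) (\<lambda>p q. b (x * p) (y * q)))"
    and right: "pair2 (rep (tmult2 scale t (cls (null2 scale) f))) b =
      pair2 (rep t) (\<lambda>x y. pair2 f (\<lambda>p q. b (x * p) (y * q)))"
    if "lin2 scale b" for b t f
    unfolding pair2_tmult2[OF that] pair2_rep_cls[OF lin2_tmult2(1)[OF that]]
      pair2_rep_cls[OF lin2_tmult2(2)[OF that]] by (rule refl)+
  show "tmult2 scale t (qadd (null2 scale) u w) =
      qadd (null2 scale) (tmult2 scale t u) (tmult2 scale t w)"
    unfolding qadd_def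
    by (rule eqI; simp add: left right; simp add: pair2_tmult2 pair2_cmult)
  show "tmult2 scale (qadd (null2 scale) u w) t =
      qadd (null2 scale) (tmult2 scale u t) (tmult2 scale w t)"
    unfolding qadd_def
    by (rule eqI; simp add: left right; simp add: pair2_tmult2 pair2_cmult)
  show "tmult2 scale t (qscale (null2 scale) c u) = qscale (null2 scale) c (tmult2 scale t u)"
    unfolding qscale_def
    by (rule eqI; simp add: left right; simp add: pair2_tmult2 pair2_cmult)
  show "tmult2 scale (qscale (null2 scale) c u) t = qscale (null2 scale) c (tmult2 scale u t)"
    unfolding qscale_def
    by (rule eqI; simp add: left right; simp add: pair2_tmult2 pair2_cmult)
  show "tmult2 scale t (cls (null2 scale) 0) = cls (null2 scale) 0"
    by (rule eqI; simp add: left right; simp add: pair2_tmult2 pair2_cmult)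
  show "tmult2 scale (cls (null2 scale) 0) t = cls (null2 scale) 0"
    by (rule eqI; simp add: left right; simp add: pair2_tmult2 pair2_cmult)
qed

lemma tensor_subalgebra_corner: "tensor_subalgebra scale (corner scale Delta)"
  unfolding tensor_subalgebra_def tensor_subspace_def
proof (intro conjI ballI allI subsetI)
  fix t u c assume tu: "t \<in> corner scale Delta" "u \<in> corner scale Delta"
  then show "qadd (null2 scale) t u \<in> corner scale Delta"
    "qscale (null2 scale) c t \<in> corner scale Delta"
    unfolding corner_iff by (simp_all add: tmult2_linear) (simp_all add: qadd_def qscale_def)
  have "tmult2 scale (Delta 1) (tmult2 scale t u) = tmult2 scale t u"
    using tu by (simp add: corner_iff flip: tmult2_assoc)
  moreover have "tmult2 scale (tmult2 scale t u) (Delta 1) = tmult2 scale t u"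
    using tu by (simp add: corner_iff tmult2_assoc)
  ultimately show "tmult2 scale t u \<in> corner scale Delta"
    by (simp add: corner_iff)
qed (simp_all add: corner_iff tmult2_linear)

text \<open>Balanced forms suffice to separate points of the corner: composing any bilinear
  \<open>b\<close> with left multiplication by \<Delta>(1) gives a balanced form \<open>?c\<close>,
  and \<open>?c\<close> agrees with \<open>b\<close> on the corner.\<close>

lemma corner_proj_inj:
  assumes t: "t \<in> corner scale Delta" and u: "u \<in> corner scale Delta"
    and eq: "cls N2 (rep t) = cls N2 (rep u)"
  shows "t = u"
proof (rule quot_null2_eqI[where s = scale])
  fix b assume b: "lin2 scale b"
  let ?c = "\<lambda>x y. sw 1 (\<lambda>u v. b (u * x) (v * y))"
  have "sw 1 (\<lambda>u v. b (u * (\<Pi>b z * x)) (v * y)) = sw 1 (\<lambda>u v. b (u * x) (v * (\<Pi> z * y)))" for x y z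
    using sw_one_balanced[of "\<lambda>u v. b (u * x) (v * y)" z] lin2D[OF b] by (simp add: lin_simps)
  then have "balanced ?c"
    unfolding balanced_iff using lin2D[OF b] by (simp add: lin_simps)
  then have "pair2 (rep t) ?c = pair2 (rep u) ?c"
    using eq by (simp add: cls_bnull2_eq_iff)
  moreover have "pair2 (rep w) ?c = pair2 (rep w) b" if "w \<in> corner scale Delta" for w
  proof -
    have "pair2 (rep w) ?c = pair2 (rep (tmult2 scale (Delta 1) w)) b"
      unfolding pair2_tmult2[OF b] sw_def by (rule pair2_swap)
    then show ?thesis using that by (simp add: corner_iff)
  qed
  ultimately show "pair2 (rep t) b = pair2 (rep u) b" using t u by simp
qed (use t u in \<open>simp_all add: corner_iff\<close>)

section \<open>Verification of the bialgebroid axioms\<close>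

lemma st_proj_eq: "st_proj scale (range \<Pi>) (\<lambda>a. a) \<Pi>b t = cls N2 (rep t)"
  by (simp add: st_proj_def st_null2_def)

lemma zero_in_corner: "cls (null2 scale) 0 \<in> corner scale Delta"
  using tensor_subalgebra_corner by (simp add: tensor_subalgebra_def tensor_subspace_def)

lemma st_ker_iff:
  "t \<in> st_ker scale (range \<Pi>) (\<lambda>a. a) \<Pi>b \<longleftrightarrow>
    t \<in> quot (null2 scale) \<and> cls N2 (rep t) = cls N2 0"
  unfolding st_ker_def st_proj_eq st_null2_def by (rule mem_Collect_eq)

lemma st_ker_corner:
  "st_ker scale (range \<Pi>) (\<lambda>a. a) \<Pi>b \<inter> corner scale Delta = {cls (null2 scale) 0}"
proof -
  have p: "cls N2 (rep (cls (null2 scale) 0)) = cls N2 0"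
    unfolding cls_bnull2_eq_iff by (simp add: balancedD(1))
  have "t = cls (null2 scale) 0"
    if "t \<in> corner scale Delta" "cls N2 (rep t) = cls N2 0" for t
    by (rule corner_proj_inj[OF that(1) zero_in_corner]) (simp only: p that(2))
  then show ?thesis
    using p zero_in_corner
    by (blast intro: st_ker_iff[THEN iffD2] cls_in_quot dest: st_ker_iff[THEN iffD1])
qed

lemma two_sided_ideal_zero: "two_sided_ideal_in scale {cls (null2 scale) 0} (corner scale Delta)"
proof -
  have "qadd (null2 scale) (cls (null2 scale) 0) (cls (null2 scale) 0) = cls (null2 scale) 0"
    "qscale (null2 scale) c (cls (null2 scale) 0) = cls (null2 scale) 0" for c
    by (simp_all add: qadd_def qscale_def cls_null2_eq_iff)
  then show ?thesis
    by (simp add: zero_in_corner two_sided_ideal_in_def tensor_subspace_def tmult2_linear)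
qed

lemma left_bialgebroid_corner:
  "left_bialgebroid_with_balancing scale (range \<Pi>) scale (\<lambda>a. a) \<Pi>b
    (\<lambda>h. st_proj scale (range \<Pi>) (\<lambda>a. a) \<Pi>b (Delta h)) \<Pi> (corner scale Delta)"
  unfolding st_proj_eq
proof (intro left_bialgebroid_with_balancing.intro source_target_ring_PiL coring_PiL
    left_bialgebroid_with_balancing_axioms.intro tensor_subalgebra_corner left_action_PiL)
  show "two_sided_ideal_in scale
      (st_ker scale (range \<Pi>) (\<lambda>a. a) \<Pi>b \<inter> corner scale Delta) (corner scale Delta)"
    unfolding st_ker_corner by (rule two_sided_ideal_zero)
  show "range Dbal \<subseteq> st_proj scale (range \<Pi>) (\<lambda>a. a) \<Pi>b ` corner scale Delta"
    using Delta_in_corner by (auto simp: st_proj_eq)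
  show "Dbal 1 = cls (st_null2 scale (range \<Pi>) (\<lambda>a. a) \<Pi>b) (gen (1, 1))"
    by (simp add: Dbal_one st_null2_def)
next
  fix t u g h
  assume "t \<in> corner scale Delta" "u \<in> corner scale Delta"
    and "st_proj scale (range \<Pi>) (\<lambda>a. a) \<Pi>b t = Dbal g"
    and "st_proj scale (range \<Pi>) (\<lambda>a. a) \<Pi>b u = Dbal h"
  \<comment> \<open>Injectivity on the corner leaves \<Delta>(g) and \<Delta>(h) as the only
    representatives there, so multiplicativity of \<Delta> itself finishes the argument.\<close>
  then have "t = Delta g" "u = Delta h"
    unfolding st_proj_eq by (simp_all only: corner_proj_inj[OF _ Delta_in_corner])
  then show "Dbal (g * h) = st_proj scale (range \<Pi>) (\<lambda>a. a) \<Pi>b (tmult2 scale t u)"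
    by (simp add: st_proj_eq Delta_mult)
qed

end

text \<open>The inclusion of the range of \<Delta> in the corner is what allows the comultiplication
  to be read as the projection restricted to \<B> composed with \<Delta>.\<close>

theorem theorem5p4:
  fixes scale :: "'k::field \<Rightarrow> 'h::{ring,monoid_mult} \<Rightarrow> 'h"
    and Delta :: "'h \<Rightarrow> ('h \<times> 'h \<Rightarrow>\<^sub>0 'k) set"
    and eps :: "'h \<Rightarrow> 'k"
    and A :: "'h set"
    and \<alpha> \<beta> :: "'h \<Rightarrow> 'h"
    and \<B> :: "('h \<times> 'h \<Rightarrow>\<^sub>0 'k) set set"
  assumes "weak_bialgebra scale Delta eps"
    and "A = range (PiL scale Delta eps)"
    and "\<alpha> = (\<lambda>a. a)"
    and "\<beta> = PiLbar scale Delta eps"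
    and "\<B> = corner scale Delta"
  shows "range Delta \<subseteq> \<B> \<and>
    left_bialgebroid_with_balancing scale A scale \<alpha> \<beta>
      (\<lambda>h. st_proj scale A \<alpha> \<beta> (Delta h)) (PiL scale Delta eps) \<B>"
proof -
  interpret weak_bialgebra scale Delta eps by fact
  show ?thesis
    unfolding assms(2-5) using Delta_in_corner left_bialgebroid_corner by blast
qed

end
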